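(* Let $\lambda>0$ and $\nu\in(0,1]$. Let $T^\nu_1,T^\nu_2,\dots$ be independent positive random variables (the sojourn or inter-birth times) such that $T^\nu_i$ has probability density $$f_{T^\nu_i}(t)=i\lambda\,t^{\nu-1}E_{\nu,\nu}(-i\lambda t^\nu),\qquad t>0,\ i\ge1,$$ and let $\mathfrak{W}^\nu_j=T^\nu_1+\cdots+T^\nu_j$ for $j\ge1$, with $\mathfrak{W}^\nu_0=0$. Let $\mathfrak{N}^\nu(t)$ be the number of individuals at time $t$ in a fractional Yule process with rate $\lambda$, with state probabilities $\mathfrak{p}^\nu_k(t)=\Pr\{\mathfrak{N}^\nu(t)=k\mid\mathfrak{N}^\nu(0)=1\}$. Then for all $j\ge1$ and $t>0$, $$\Pr(\mathfrak{W}^\nu_j\le t)=\Pr(\mathfrak{N}^\nu(t)\ge j+1\mid\mathfrak{N}^\nu(0)=1)=1-\sum_{k=1}^j\sum_{l=1}^k\binom{k-1}{l-1}(-1)^{l-1}E_{\nu,1}(-\lambda l t^\nu),$$ $$\mathfrak{p}^\nu_j(t)=\Pr(\mathfrak{W}^\nu_{j-1}\le t)-\Pr(\mathfrak{W}^\nu_j\le t),$$ and the $j$th birth (waiting) time $\mathfrak{W}^\nu_j$ has probability density $$f_{\mathfrak{W}^\nu_j}(t)=\sum_{k=1}^j\sum_{l=1}^k\binom{k-1}{l-1}(-1)^{l-1}(\lambda l)\,t^{\nu-1}E_{\nu,\nu}(-\lambda l t^\nu),\qquad t>0.$$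
   Context: Generalized Mittag-Leffler function: $E_{\alpha,\beta}(\tau)=\sum_{r=0}^\infty\frac{\tau^r}{\Gamma(\alpha r+\beta)}$, $\alpha,\beta>0$. Fractional Yule process with rate $\lambda$: its state probabilities $\mathfrak{p}^\nu_k(t)$ are the solution of $\frac{d^\nu}{dt^\nu}\mathfrak{p}^\nu_k(t)=-\lambda k\,\mathfrak{p}^\nu_k(t)+\lambda(k-1)\mathfrak{p}^\nu_{k-1}(t)$, $k\ge1$, with $\mathfrak{p}^\nu_1(0)=1$ and $\mathfrak{p}^\nu_k(0)=0$ for $k>1$, where $\frac{d^\nu}{dt^\nu}$ is the Caputo derivative, $\frac{1}{\Gamma(1-\nu)}\int_0^t\frac{f'(s)}{(t-s)^\nu}ds$ for $\nu\in(0,1)$ and $f'(t)$ for $\nu=1$. Explicitly, $\mathfrak{p}^\nu_k(t)=\sum_{l=1}^k\binom{k-1}{l-1}(-1)^{l-1}E_{\nu,1}(-\lambda l t^\nu)$, $k\ge1$. *)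

theory Defs
  imports "HOL-Probability.Probability"
begin

definition mittag_leffler :: "real \<Rightarrow> real \<Rightarrow> real \<Rightarrow> real" where
  "mittag_leffler \<alpha> \<beta> \<tau> = (\<Sum>r. \<tau> ^ r / Gamma (\<alpha> * real r + \<beta>))"

text \<open>
  Caputo derivative of order \<open>\<nu> \<in> (0, 1]\<close>. As \<open>deriv\<close> and the Lebesgue integral are total,
  the existence of the derivative at \<open>t\<close> is the separate predicate \<open>caputo_differentiable\<close>.
  Integrability of the weighted derivative makes \<open>f'\<close> itself integrable on \<open>(0, t)\<close>, since
  \<open>(t - s) powr \<nu>\<close> is bounded there.
\<close>

definition caputo_deriv :: "real \<Rightarrow> (real \<Rightarrow> real) \<Rightarrow> real \<Rightarrow> real" where
  "caputo_deriv \<nu> f t =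
     (if \<nu> = 1 then deriv f t
      else 1 / Gamma (1 - \<nu>) * (LINT s:{0<..<t}|lborel. deriv f s / (t - s) powr \<nu>))"

definition caputo_differentiable :: "real \<Rightarrow> (real \<Rightarrow> real) \<Rightarrow> real \<Rightarrow> bool" where
  "caputo_differentiable \<nu> f t \<longleftrightarrow>
     (if \<nu> = 1 then f field_differentiable (at t)
      else (\<forall>s\<in>{0<..<t}. f field_differentiable (at s)) \<and>
           set_integrable lborel {0<..<t} (\<lambda>s. deriv f s / (t - s) powr \<nu>))"

text \<open>
  Continuity on \<open>[0, \<infinity>)\<close> ties the initial values to the equations, which are imposed for \<open>t > 0\<close>.
  For \<open>k = 1\<close> the term with \<open>p (k - 1)\<close> has coefficient \<open>0\<close>.
\<close>

definition fractional_yule_system :: "real \<Rightarrow> real \<Rightarrow> (nat \<Rightarrow> real \<Rightarrow> real) \<Rightarrow> bool" where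
  "fractional_yule_system lam \<nu> p \<longleftrightarrow>
     p 1 0 = 1 \<and> (\<forall>k>1. p k 0 = 0) \<and>
     (\<forall>k\<ge>1. continuous_on {0..} (p k) \<and>
        (\<forall>t>0. caputo_differentiable \<nu> (p k) t \<and>
           caputo_deriv \<nu> (p k) t
             = - lam * real k * p k t + lam * (real k - 1) * p (k - 1) t))"

definition state_prob :: "'a measure \<Rightarrow> (real \<Rightarrow> 'a \<Rightarrow> nat) \<Rightarrow> nat \<Rightarrow> real \<Rightarrow> real" where
  "state_prob M N k t = \<P>(\<omega> in M. N t \<omega> = k \<bar> N 0 \<omega> = 1)"

text \<open>
  The population size takes values in \<open>{1, 2, \<dots>}\<close>. Only the one-dimensional state
  probabilities are prescribed.
\<close>

definition fractional_yule_process ::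
    "'a measure \<Rightarrow> (real \<Rightarrow> 'a \<Rightarrow> nat) \<Rightarrow> real \<Rightarrow> real \<Rightarrow> bool" where
  "fractional_yule_process M N lam \<nu> \<longleftrightarrow>
     prob_space M \<and>
     (\<forall>t\<ge>0. N t \<in> M \<rightarrow>\<^sub>M count_space {1..}) \<and>
     \<P>(\<omega> in M. N 0 \<omega> = 1) > 0 \<and>
     fractional_yule_system lam \<nu> (state_prob M N)"

text \<open>
  Nonnegativity is part of the notion, because \<open>ennreal\<close> would silently truncate negative values.
\<close>

definition has_pdf :: "'a measure \<Rightarrow> ('a \<Rightarrow> real) \<Rightarrow> (real \<Rightarrow> real) \<Rightarrow> bool" where
  "has_pdf M X f \<longleftrightarrow> (\<forall>x. 0 \<le> f x) \<and> distributed M lborel X (\<lambda>x. ennreal (f x))"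

definition waiting_time :: "(nat \<Rightarrow> 'a \<Rightarrow> real) \<Rightarrow> nat \<Rightarrow> 'a \<Rightarrow> real" where
  "waiting_time T j \<omega> = (\<Sum>i=1..j. T i \<omega>)"

end

theory Submission
  imports Defs "HOL-Real_Asymp.Real_Asymp"
begin

text \<open>
  The idea is to integrate everything fractionally. Let \<open>I\<close> be the Riemann-Liouville integral of
  order \<open>\<nu>\<close> (\<open>frac_int\<close>). Three families of functions of \<open>t > 0\<close> then satisfy the same recursion

    \<open>A 0 = 1\<close>,  \<open>A (j + 1) = lam * (j + 1) * I (A j - A (j + 1))\<close>,

  called \<open>tail_cascade\<close> below, and the recursion has only one locally bounded solution.

  The distribution functions of the waiting times satisfy it (\<open>tail_cascade_waiting_time\<close>). A
  sojourn time with parameter \<open>c\<close> has a survival function \<open>E\<close>, the Mittag-Leffler function at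
  \<open>- c * t powr \<nu>\<close>, for which \<open>1 - E = c * I E\<close>. Adding an independent nonnegative variable
  \<open>W\<close> to it translates this identity by \<open>W\<close> and averages (\<open>cdf_add_frac_int\<close>).

  The tail probabilities of the Yule process satisfy it (\<open>tail_cascade_yule\<close>). Applying \<open>I\<close> to a
  Caputo derivative gives back the function minus its initial value (\<open>frac_int_caputo_deriv\<close>), and
  the integrated equations telescope when they are added.

  The explicit alternating sums of Mittag-Leffler functions satisfy it (\<open>tail_cascade_ml_tail\<close>),
  by the same identity \<open>1 - E = c * I E\<close> and the absorption identity for binomial coefficients.

  Uniqueness (\<open>tail_cascade_unique\<close>) is an induction on \<open>j\<close>: the difference of two solutions
  solves a homogeneous Volterra equation \<open>d = - c * I d\<close>, and iterating it bounds \<open>d\<close> by the terms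
  of a convergent Mittag-Leffler series (\<open>volterra_unique\<close>). Hence the three families coincide. The
  density of the waiting time is the derivative of the explicit sum (\<open>has_pdf_waiting_time\<close>).
\<close>

section \<open>Mittag-Leffler functions of order at most one\<close>

lemma Gamma_plus1_pos:
  fixes x :: real
  assumes "0 < x"
  shows "Gamma (x + 1) = x * Gamma x"
  using assms by (intro Gamma_plus1) (auto elim: nonpos_Ints_cases')

lemma Gamma_nonzero_pos:
  fixes x :: real
  assumes "0 < x"
  shows "Gamma x \<noteq> 0"
  using assms by (metis Gamma_real_pos less_irrefl)

text \<open>
  \<open>x + 1\<close> is the convex combination of \<open>x + \<nu>\<close> and \<open>x + \<nu> + 1\<close> with weights \<open>\<nu>\<close> and \<open>1 - \<nu>\<close>,
  so the bound is the log-convexity of the Gamma function combined with its functional equation.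
\<close>

lemma Gamma_ratio_le:
  fixes x \<nu> :: real
  assumes "0 < \<nu>" "\<nu> \<le> 1" "0 < x"
  shows "Gamma x / Gamma (x + \<nu>) \<le> (x + \<nu>) powr (1 - \<nu>) / x"
proof -
  have pos: "Gamma (x + \<nu>) > 0" "Gamma (x + \<nu> + 1) > 0" "Gamma (x + 1) > 0" "Gamma x > 0"
    using assms by (auto intro!: Gamma_real_pos)
  have "(ln \<circ> Gamma) ((1 - (1 - \<nu>)) *\<^sub>R (x + \<nu>) + (1 - \<nu>) *\<^sub>R (x + \<nu> + 1))
      \<le> (1 - (1 - \<nu>)) * (ln \<circ> Gamma) (x + \<nu>) + (1 - \<nu>) * (ln \<circ> Gamma) (x + \<nu> + 1)"
    using assms by (intro convex_onD[OF log_convex_Gamma_real]) auto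
  also have "(1 - (1 - \<nu>)) *\<^sub>R (x + \<nu>) + (1 - \<nu>) *\<^sub>R (x + \<nu> + 1) = x + 1"
    by (simp add: algebra_simps)
  also have "(ln \<circ> Gamma) (x + \<nu> + 1) = ln (x + \<nu>) + ln (Gamma (x + \<nu>))"
    unfolding o_def using assms pos(1) by (subst Gamma_plus1_pos, simp, subst ln_mult_pos) auto
  finally have "ln (Gamma (x + 1)) \<le> ln (Gamma (x + \<nu>)) + (1 - \<nu>) * ln (x + \<nu>)"
    by (simp add: algebra_simps)
  also have "\<dots> = ln (Gamma (x + \<nu>) * (x + \<nu>) powr (1 - \<nu>))"
    using assms pos(1) by (subst ln_mult_pos) (auto simp: ln_powr)
  finally have "Gamma (x + 1) \<le> Gamma (x + \<nu>) * (x + \<nu>) powr (1 - \<nu>)"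
    using assms pos by (subst (asm) ln_le_cancel_iff) auto
  moreover have "Gamma (x + 1) = x * Gamma x"
    using assms by (simp add: Gamma_plus1_pos)
  ultimately show ?thesis
    using assms pos by (simp add: field_simps)
qed

text \<open>
  Ratio test: by the bound on the quotient of Gamma values, consecutive terms have a quotient of
  order \<open>r powr (- \<nu>)\<close>.
\<close>

lemma summable_mittag_leffler:
  assumes "0 < \<nu>" "\<nu> \<le> 1" "0 < \<beta>"
  shows "summable (\<lambda>r. z ^ r / Gamma (\<nu> * real r + \<beta>))"
proof -
  have "((\<lambda>x::real. \<bar>z\<bar> * ((x + \<nu>) powr (1 - \<nu>) / x)) \<longlongrightarrow> 0) at_top"
    using assms by real_asymp
  then have "\<forall>\<^sub>F x in at_top. \<bar>z\<bar> * ((x + \<nu>) powr (1 - \<nu>) / x) < 1 / 2"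
    by (rule order_tendstoD) auto
  moreover have "filterlim (\<lambda>r. \<nu> * real r + \<beta>) at_top sequentially"
    using assms by real_asymp
  ultimately have "\<forall>\<^sub>F r in sequentially.
      \<bar>z\<bar> * ((\<nu> * real r + \<beta> + \<nu>) powr (1 - \<nu>) / (\<nu> * real r + \<beta>)) < 1 / 2"
    using eventually_compose_filterlim by blast
  then obtain n0 where n0: "\<And>r. r \<ge> n0 \<Longrightarrow>
      \<bar>z\<bar> * ((\<nu> * real r + \<beta> + \<nu>) powr (1 - \<nu>) / (\<nu> * real r + \<beta>)) < 1 / 2"
    by (auto simp: eventually_sequentially)
  show ?thesis
  proof (rule summable_ratio_test[of "1/2" n0])
    fix r assume r: "n0 \<le> r"
    define x where "x = \<nu> * real r + \<beta>"
    have x: "x > 0" using assms by (auto simp: x_def intro!: add_nonneg_pos)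
    have x': "\<nu> * real (Suc r) + \<beta> = x + \<nu>" by (simp add: x_def algebra_simps)
    have pos: "Gamma x > 0" "Gamma (x + \<nu>) > 0"
      using assms x by (auto intro!: Gamma_real_pos)
    have "\<bar>z\<bar> * (Gamma x / Gamma (x + \<nu>)) \<le> \<bar>z\<bar> * ((x + \<nu>) powr (1 - \<nu>) / x)"
      using Gamma_ratio_le[of \<nu> x] assms x by (intro mult_left_mono) auto
    also have "\<dots> \<le> 1 / 2" using n0[OF r] by (simp add: x_def)
    finally have "\<bar>z\<bar> / Gamma (x + \<nu>) \<le> 1 / 2 * (1 / Gamma x)"
      using pos by (simp add: field_simps)
    from mult_left_mono[OF this, of "\<bar>z\<bar> ^ r"]
    show "norm (z ^ Suc r / Gamma (\<nu> * real (Suc r) + \<beta>))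
        \<le> 1 / 2 * norm (z ^ r / Gamma (\<nu> * real r + \<beta>))"
      unfolding x' x_def[symmetric] using pos
      by (simp add: abs_mult power_abs mult_ac)
  qed auto
qed

lemma mittag_leffler_0 [simp]: "mittag_leffler \<nu> 1 0 = 1"
proof -
  have "(\<Sum>r. 0 ^ r / Gamma (\<nu> * real r + 1)) = (\<Sum>r\<in>{0}. 0 ^ r / Gamma (\<nu> * real r + 1))"
    by (rule suminf_finite) auto
  then show ?thesis by (simp add: mittag_leffler_def)
qed

lemma DERIV_mittag_leffler:
  assumes "0 < \<nu>" "\<nu> \<le> 1"
  shows "(mittag_leffler \<nu> 1 has_real_derivative mittag_leffler \<nu> \<nu> z / \<nu>) (at z)"
proof -
  let ?c = "\<lambda>r. 1 / Gamma (\<nu> * real r + 1)"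
  have "((\<lambda>z. \<Sum>r. ?c r * z ^ r) has_field_derivative (\<Sum>r. diffs ?c r * z ^ r)) (at z)"
    by (rule termdiffs_strong_converges_everywhere)
       (use summable_mittag_leffler[OF assms] in simp)
  moreover have "(\<lambda>z. \<Sum>r. ?c r * z ^ r) = mittag_leffler \<nu> 1"
    by (simp add: fun_eq_iff mittag_leffler_def)
  moreover have eq: "\<nu> * real r + \<nu> = \<nu> * real (Suc r)" for r
    by (simp add: algebra_simps)
  have "diffs ?c r * z ^ r = z ^ r / Gamma (\<nu> * real r + \<nu>) / \<nu>" for r
  proof -
    have "Gamma (\<nu> * real (Suc r) + 1) = \<nu> * real (Suc r) * Gamma (\<nu> * real (Suc r))"
      using assms by (intro Gamma_plus1_pos) auto
    then show ?thesis
      using assms unfolding eq by (simp add: diffs_def field_simps del: of_nat_Suc)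
  qed
  then have "(\<Sum>r. diffs ?c r * z ^ r) = mittag_leffler \<nu> \<nu> z / \<nu>"
    using assms by (simp add: mittag_leffler_def suminf_divide summable_mittag_leffler del: divide_divide_eq_left)
  ultimately show ?thesis by simp
qed

lemma continuous_on_mittag_leffler:
  assumes "0 < \<nu>" "\<nu> \<le> 1" "0 < \<beta>"
  shows "continuous_on UNIV (mittag_leffler \<nu> \<beta>)"
proof -
  have "isCont (\<lambda>z. \<Sum>r. 1 / Gamma (\<nu> * real r + \<beta>) * z ^ r) z" for z
    by (rule isCont_powser_converges_everywhere) (use summable_mittag_leffler[OF assms] in simp)
  then show ?thesis
    by (intro continuous_at_imp_continuous_on) (simp add: mittag_leffler_def[abs_def])
qed

text \<open>
  For \<open>c > 0\<close> this is the survival function of the waiting time with density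
  \<open>c * t powr (\<nu> - 1) * mittag_leffler \<nu> \<nu> (- c * t powr \<nu>)\<close>, and the eigenfunction of the Caputo
  derivative for the eigenvalue \<open>- c\<close>; for \<open>\<nu> = 1\<close> it is \<open>exp (- c * t)\<close>.
\<close>

definition ml_survival :: "real \<Rightarrow> real \<Rightarrow> real \<Rightarrow> real" where
  "ml_survival \<nu> c t = mittag_leffler \<nu> 1 (- c * t powr \<nu>)"

lemma ml_survival_simps [simp]: "ml_survival \<nu> c 0 = 1" "ml_survival \<nu> 0 t = 1"
  by (simp_all add: ml_survival_def)

lemma DERIV_ml_survival:
  assumes "0 < \<nu>" "\<nu> \<le> 1" "0 < t"
  shows "(ml_survival \<nu> c has_real_derivative
           - (c * t powr (\<nu> - 1) * mittag_leffler \<nu> \<nu> (- c * t powr \<nu>))) (at t)"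
proof -
  have "((\<lambda>t. - c * t powr \<nu>) has_real_derivative - c * (\<nu> * t powr (\<nu> - 1))) (at t)"
    using assms by (auto intro!: derivative_eq_intros)
  from DERIV_chain2[OF DERIV_mittag_leffler[OF assms(1,2)] this]
  show ?thesis
    using assms unfolding ml_survival_def[abs_def] by (simp add: field_simps)
qed

lemma continuous_on_ml_survival:
  assumes "0 < \<nu>" "\<nu> \<le> 1"
  shows "continuous_on {0..} (ml_survival \<nu> c)"
proof -
  have "continuous_on UNIV (mittag_leffler \<nu> 1)"
    by (intro continuous_on_mittag_leffler assms) simp
  moreover have "continuous_on {0..} (\<lambda>t. - c * t powr \<nu>)"
    using assms by (intro continuous_intros continuous_on_powr') auto
  ultimately show ?thesis
    unfolding ml_survival_def[abs_def]
    by (rule continuous_on_compose2) auto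
qed

lemma ml_survival_sums:
  assumes "0 < \<nu>" "\<nu> \<le> 1"
  shows "(\<lambda>r. (- c * t powr \<nu>) ^ r / Gamma (\<nu> * real r + 1)) sums ml_survival \<nu> c t"
  unfolding ml_survival_def mittag_leffler_def
  by (intro summable_sums summable_mittag_leffler assms) simp

section \<open>Fractional integrals\<close>

text \<open>
  The substitution \<open>s \<mapsto> (s - x) / (y - x)\<close> turns this into the Euler integral over the unit interval.
\<close>

lemma has_bochner_integral_Beta:
  fixes a b x y :: real
  assumes "0 < a" "0 < b" "x < y"
  shows "has_bochner_integral lborel
           (\<lambda>s. indicator {x<..<y} s * ((y - s) powr (b - 1) * (s - x) powr (a - 1)))
           (Beta a b * (y - x) powr (a + b - 1))"
proof -
  let ?g = "\<lambda>s::real. s powr (a - 1) * (1 - s) powr (b - 1)"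
  let ?h = "\<lambda>s. indicator {0<..<1} s *\<^sub>R ?g s"
  have I: "set_integrable lborel {0<..<1} ?g"
    by (rule set_integrable_subset[OF integrable_Beta[OF assms(1,2)]]) auto
  have "(LINT s:{0<..<1}|lborel. ?g s) = Beta a b"
    unfolding set_borel_integral_eq_integral(2)[OF I]
    using has_integral_Beta_real[OF assms(1,2)]
    by (simp add: has_integral_Icc_iff_Ioo integral_unique)
  with I have "has_bochner_integral lborel ?h (Beta a b)"
    by (simp add: has_bochner_integral_iff set_integrable_def set_lebesgue_integral_def)
  with lborel_has_bochner_integral_real_affine_iff[of "1/(y - x)" ?h "Beta a b" "- x/(y - x)"]
  have "has_bochner_integral lborel (\<lambda>s. ?h (- x/(y - x) + 1/(y - x) * s)) (Beta a b /\<^sub>R \<bar>1/(y - x)\<bar>)"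
    using assms by simp
  from has_bochner_integral_mult_right[OF this, of "(y - x) powr (a + b - 2)"]
  have "has_bochner_integral lborel
      (\<lambda>s. (y - x) powr (a + b - 2) * ?h (- x/(y - x) + 1/(y - x) * s))
      ((y - x) powr (a + b - 2) * (Beta a b * (y - x)))"
    using assms by (simp add: mult.commute)
  also have "(\<lambda>s. (y - x) powr (a + b - 2) * ?h (- x/(y - x) + 1/(y - x) * s))
      = (\<lambda>s. indicator {x<..<y} s * ((y - s) powr (b - 1) * (s - x) powr (a - 1)))"
  proof
    fix s
    have e: "- x/(y - x) + 1/(y - x) * s = (s - x)/(y - x)"
      by (simp add: diff_divide_distrib)
    have e': "1 - (s - x)/(y - x) = (y - s)/(y - x)"
      using assms by (simp add: field_simps)
    show "(y - x) powr (a + b - 2) * ?h (- x/(y - x) + 1/(y - x) * s)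
        = indicator {x<..<y} s * ((y - s) powr (b - 1) * (s - x) powr (a - 1))"
    proof (cases "s \<in> {x<..<y}")
      case True
      have "(y - x) powr (a + b - 2) = (y - x) powr (a - 1) * (y - x) powr (b - 1)"
        by (simp add: powr_add[symmetric])
      with True show ?thesis
        unfolding e e' using assms by (simp add: powr_divide)
    next
      case False
      then show ?thesis
        unfolding e using assms by (auto simp: indicator_def field_simps)
    qed
  qed
  also have "(y - x) powr (a + b - 2) * (Beta a b * (y - x)) = Beta a b * (y - x) powr (a + b - 1)"
  proof -
    have "(y - x) * (y - x) powr (a + b - 2) = (y - x) powr (a + b - 1)"
      using powr_mult_base[of "y - x" "a + b - 2"] assms by simp
    then show ?thesis by (simp add: mult_ac)
  qed
  finally show ?thesis .
qed

text \<open>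
  The Riemann-Liouville integral of order \<open>\<nu>\<close>. Its value at \<open>t\<close> depends on the function only
  inside \<open>(0, t)\<close>, which is what makes the induction over the generations possible.
\<close>

definition frac_int :: "real \<Rightarrow> (real \<Rightarrow> real) \<Rightarrow> real \<Rightarrow> real" where
  "frac_int \<nu> f t = 1 / Gamma \<nu> * (LINT s:{0<..<t}|lborel. (t - s) powr (\<nu> - 1) * f s)"

text \<open>
  The functions that occur are either continuous on \<open>[0, \<infinity>)\<close> or distribution functions; this
  notion covers both and suffices for the weakly singular kernel \<open>(t - s) powr (\<nu> - 1)\<close>.
\<close>

definition loc_bounded :: "(real \<Rightarrow> real) \<Rightarrow> bool" where
  "loc_bounded f \<longleftrightarrow> set_borel_measurable lborel {0<..} f \<and>
     (\<forall>t>0. \<exists>B. \<forall>s\<in>{0<..<t}. \<bar>f s\<bar> \<le> B)"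

lemma loc_bounded_const: "loc_bounded (\<lambda>_. c)"
  by (auto simp: loc_bounded_def set_borel_measurable_def)

lemma loc_bounded_diff:
  assumes "loc_bounded f" "loc_bounded g"
  shows "loc_bounded (\<lambda>s. f s - g s)"
proof -
  have "\<exists>B. \<forall>s\<in>{0<..<t}. \<bar>f s - g s\<bar> \<le> B" if "t > 0" for t
  proof -
    obtain B where B: "\<forall>s\<in>{0<..<t}. \<bar>f s\<bar> \<le> B"
      using assms(1) \<open>t > 0\<close> unfolding loc_bounded_def by blast
    obtain C where C: "\<forall>s\<in>{0<..<t}. \<bar>g s\<bar> \<le> C"
      using assms(2) \<open>t > 0\<close> unfolding loc_bounded_def by blast
    have "\<bar>f s - g s\<bar> \<le> B + C" if "s \<in> {0<..<t}" for s
      using B[rule_format, OF that] C[rule_format, OF that] by linarith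
    then show ?thesis by blast
  qed
  with assms show ?thesis
    by (auto simp: loc_bounded_def set_borel_measurable_def right_diff_distrib)
qed

lemma loc_bounded_cmult:
  assumes "loc_bounded f"
  shows "loc_bounded (\<lambda>s. c * f s)"
proof -
  have "\<exists>B. \<forall>s\<in>{0<..<t}. \<bar>c * f s\<bar> \<le> B" if t: "t > 0" for t
  proof -
    obtain B where "\<forall>s\<in>{0<..<t}. \<bar>f s\<bar> \<le> B"
      using assms t unfolding loc_bounded_def by blast
    then show ?thesis
      by (intro exI[of _ "\<bar>c\<bar> * B"]) (auto simp: abs_mult intro!: mult_left_mono)
  qed
  with assms show ?thesis
    by (auto simp: loc_bounded_def set_borel_measurable_def mult.left_commute)
qed

lemma loc_bounded_sum:
  assumes "\<And>i. i \<in> A \<Longrightarrow> loc_bounded (f i)"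
  shows "loc_bounded (\<lambda>s. \<Sum>i\<in>A. f i s)"
  using assms
proof (induction A rule: infinite_finite_induct)
  case (insert i A)
  then have "loc_bounded (\<lambda>s. f i s - (-1) * (\<Sum>i\<in>A. f i s))"
    by (intro loc_bounded_diff loc_bounded_cmult) auto
  with insert show ?case by simp
qed (auto simp: loc_bounded_const)

lemma loc_bounded_continuous:
  assumes "continuous_on {0..} f"
  shows "loc_bounded f"
proof -
  have "set_borel_measurable borel {0<..} f"
    unfolding set_borel_measurable_def
    by (rule borel_measurable_continuous_on_indicator) (use assms in \<open>auto intro: continuous_on_subset\<close>)
  moreover have "\<exists>B. \<forall>s\<in>{0<..<t}. \<bar>f s\<bar> \<le> B" for t
  proof -
    have "bounded (f ` {0..t})"
      by (intro compact_imp_bounded compact_continuous_image continuous_on_subset[OF assms]) auto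
    then obtain B where "\<forall>s\<in>{0..t}. \<bar>f s\<bar> \<le> B"
      by (auto simp: bounded_iff)
    then show ?thesis by (intro exI[of _ B]) auto
  qed
  ultimately show ?thesis
    by (auto simp: loc_bounded_def set_borel_measurable_def)
qed

lemma set_integrable_frac_kernel:
  fixes \<nu> t :: real
  assumes "0 < \<nu>"
  shows "set_integrable lborel {0<..<t} (\<lambda>s. (t - s) powr (\<nu> - 1))"
proof (cases "0 < t")
  case True
  have "set_integrable lborel {0<..<t} (\<lambda>s. (t - s) powr (\<nu> - 1) * (s - 0) powr (1 - 1))"
    using has_bochner_integral_Beta[of 1 \<nu> 0 t] assms True
    unfolding set_integrable_def real_scaleR_def has_bochner_integral_iff by simp
  also have "?this \<longleftrightarrow> ?thesis"
    by (rule set_integrable_cong) auto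
  finally show ?thesis .
qed auto

lemma set_integrable_frac:
  assumes "0 < \<nu>" "loc_bounded f"
  shows "set_integrable lborel {0<..<t} (\<lambda>s. (t - s) powr (\<nu> - 1) * f s)"
proof (cases "0 < t")
  case True
  then obtain B where B: "\<And>s. s \<in> {0<..<t} \<Longrightarrow> \<bar>f s\<bar> \<le> B"
    using assms unfolding loc_bounded_def by blast
  have "set_integrable lborel {0<..<t} (\<lambda>s. (t - s) powr (\<nu> - 1) * B)"
    by (intro set_integrable_mult_left set_integrable_frac_kernel assms(1))
  then show ?thesis
  proof (rule set_integrable_bound)
    have [measurable]: "(\<lambda>s. indicator {0<..} s * f s) \<in> borel_measurable borel"
      using assms by (simp add: loc_bounded_def set_borel_measurable_def)
    have "(\<lambda>s. indicator {0<..<t} s * (t - s) powr (\<nu> - 1) * (indicator {0<..} s * f s))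
        \<in> borel_measurable borel"
      by measurable
    also have "(\<lambda>s. indicator {0<..<t} s * (t - s) powr (\<nu> - 1) * (indicator {0<..} s * f s))
        = (\<lambda>s. indicator {0<..<t} s * ((t - s) powr (\<nu> - 1) * f s))"
      by (auto simp: indicator_def)
    finally show "set_borel_measurable lborel {0<..<t} (\<lambda>s. (t - s) powr (\<nu> - 1) * f s)"
      by (simp add: set_borel_measurable_def)
    have "\<bar>f s\<bar> \<le> \<bar>B\<bar>" if "s \<in> {0<..<t}" for s
      using B[OF that] by linarith
    then show "AE s in lborel. s \<in> {0<..<t} \<longrightarrow>
        norm ((t - s) powr (\<nu> - 1) * f s) \<le> norm ((t - s) powr (\<nu> - 1) * B)"
      by (auto simp: abs_mult intro!: mult_left_mono)
  qed
qed auto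

lemma frac_int_cong:
  assumes "\<And>s. 0 < s \<Longrightarrow> s < t \<Longrightarrow> f s = g s"
  shows "frac_int \<nu> f t = frac_int \<nu> g t"
  unfolding frac_int_def
  by (intro arg_cong[where f="\<lambda>x. 1 / Gamma \<nu> * x"] set_lebesgue_integral_cong)
     (auto simp: assms)

lemma frac_int_diff:
  assumes "0 < \<nu>" "loc_bounded f" "loc_bounded g"
  shows "frac_int \<nu> (\<lambda>s. f s - g s) t = frac_int \<nu> f t - frac_int \<nu> g t"
  using assms
  by (simp add: frac_int_def right_diff_distrib set_integrable_frac)

lemma frac_int_cmult: "frac_int \<nu> (\<lambda>s. c * f s) t = c * frac_int \<nu> f t"
  unfolding frac_int_def by (simp add: mult.left_commute[of _ c])

lemma frac_int_sum:
  assumes "0 < \<nu>" "\<And>i. i \<in> A \<Longrightarrow> loc_bounded (f i)"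
  shows "frac_int \<nu> (\<lambda>s. \<Sum>i\<in>A. f i s) t = (\<Sum>i\<in>A. frac_int \<nu> (f i) t)"
  using assms(2)
proof (induction A rule: infinite_finite_induct)
  case (insert i A)
  have "frac_int \<nu> (\<lambda>s. f i s - (-1) * (\<Sum>i\<in>A. f i s)) t
      = frac_int \<nu> (f i) t - frac_int \<nu> (\<lambda>s. (-1) * (\<Sum>i\<in>A. f i s)) t"
    using insert assms(1)
    by (intro frac_int_diff loc_bounded_cmult loc_bounded_sum) auto
  also have "\<dots> = frac_int \<nu> (f i) t + (\<Sum>i\<in>A. frac_int \<nu> (f i) t)"
    using insert by (subst frac_int_cmult) auto
  finally show ?case using insert by simp
qed (simp_all add: frac_int_def)

text \<open>
  One term of the Mittag-Leffler series under the kernel: a Beta integral that shifts the Gamma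
  argument by \<open>\<nu>\<close>. It drives both the termwise integration of the series and, with \<open>c \<ge> 0\<close>,
  the iteration bound behind uniqueness.
\<close>

lemma has_bochner_integral_ml_term:
  assumes "0 < \<nu>" "0 < t"
  shows "has_bochner_integral lborel
           (\<lambda>s. indicator {0<..<t} s *
              ((t - s) powr (\<nu> - 1) * ((c * s powr \<nu>) ^ r / Gamma (\<nu> * real r + 1))))
           (Gamma \<nu> * t powr \<nu> * ((c * t powr \<nu>) ^ r / Gamma (\<nu> * real r + (\<nu> + 1))))"
proof -
  have pow: "(x powr \<nu>) ^ r = x powr (\<nu> * real r)" if "x > 0" for x :: real
    using that by (simp add: powr_realpow[symmetric] powr_powr)
  have pos: "Gamma (\<nu> * real r + 1) > 0"
    using assms by (intro Gamma_real_pos) (auto intro!: add_nonneg_pos)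
  have "has_bochner_integral lborel
      (\<lambda>s. c ^ r / Gamma (\<nu> * real r + 1) *
        (indicator {0<..<t} s * ((t - s) powr (\<nu> - 1) * (s - 0) powr (\<nu> * real r + 1 - 1))))
      (c ^ r / Gamma (\<nu> * real r + 1) *
        (Beta (\<nu> * real r + 1) \<nu> * (t - 0) powr (\<nu> * real r + 1 + \<nu> - 1)))"
    using assms
    by (intro has_bochner_integral_mult_right has_bochner_integral_Beta) (auto intro!: add_nonneg_pos)
  also have "(\<lambda>s. c ^ r / Gamma (\<nu> * real r + 1) *
        (indicator {0<..<t} s * ((t - s) powr (\<nu> - 1) * (s - 0) powr (\<nu> * real r + 1 - 1))))
      = (\<lambda>s. indicator {0<..<t} s *
          ((t - s) powr (\<nu> - 1) * ((c * s powr \<nu>) ^ r / Gamma (\<nu> * real r + 1))))"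
    by (auto simp: indicator_def power_mult_distrib pow)
  also have "c ^ r / Gamma (\<nu> * real r + 1) *
        (Beta (\<nu> * real r + 1) \<nu> * (t - 0) powr (\<nu> * real r + 1 + \<nu> - 1))
      = Gamma \<nu> * t powr \<nu> * ((c * t powr \<nu>) ^ r / Gamma (\<nu> * real r + (\<nu> + 1)))"
    using assms pos
    by (simp add: Beta_def power_mult_distrib pow powr_add add_ac)
  finally show ?thesis .
qed

text \<open>
  Fractional integration maps the \<open>r\<close>-th term of the series to a multiple of the \<open>(r + 1)\<close>-st,
  so the shifted series lacks only its constant term.
\<close>

lemma frac_int_ml_survival:
  assumes "0 < \<nu>" "\<nu> \<le> 1" "0 < t"
  shows "c * frac_int \<nu> (ml_survival \<nu> c) t = 1 - ml_survival \<nu> c t"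
proof -
  define F where "F = (\<lambda>c r s. indicator {0<..<t} s *
      ((t - s) powr (\<nu> - 1) * ((c * s powr \<nu>) ^ r / Gamma (\<nu> * real r + 1))))"
  define G where "G = (\<lambda>c r. Gamma \<nu> * t powr \<nu> * ((c * t powr \<nu>) ^ r / Gamma (\<nu> * real r + (\<nu> + 1))))"
  have FG: "has_bochner_integral lborel (F c r) (G c r)" for c r
    unfolding F_def G_def using assms by (intro has_bochner_integral_ml_term)
  have pos: "Gamma (\<nu> * real r + 1) > 0" for r
    using assms by (intro Gamma_real_pos) (auto intro!: add_nonneg_pos)
  have gnz: "Gamma \<nu> \<noteq> 0"
    using assms(1) by (rule Gamma_nonzero_pos)
  \<comment> \<open>Taking norms replaces the parameter \<open>- c\<close> by \<open>\<bar>c\<bar>\<close> and stays within the same family of terms.\<close>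
  have norm_F: "norm (F (- c) r s) = F \<bar>c\<bar> r s" for r s
    using pos[of r] by (simp add: F_def abs_mult power_abs)
  have sumF: "summable (\<lambda>r. F d r s)" for d s
    unfolding F_def using assms by (intro summable_mult summable_mittag_leffler) auto
  have sumG: "summable (G d)" for d
    unfolding G_def using assms by (intro summable_mult summable_mittag_leffler) auto
  have "(\<lambda>r. integral\<^sup>L lborel (F (- c) r)) sums (\<integral>s. (\<Sum>r. F (- c) r s) \<partial>lborel)"
  proof (rule sums_integral)
    show "integrable lborel (F (- c) r)" for r
      using FG by (simp add: has_bochner_integral_iff)
    show "AE s in lborel. summable (\<lambda>r. norm (F (- c) r s))"
      unfolding norm_F using sumF by simp
    show "summable (\<lambda>r. \<integral>s. norm (F (- c) r s) \<partial>lborel)"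
      unfolding norm_F using FG sumG by (simp add: has_bochner_integral_iff)
  qed
  moreover have "(\<Sum>r. F (- c) r s)
      = indicator {0<..<t} s * ((t - s) powr (\<nu> - 1) * ml_survival \<nu> c s)" for s
    unfolding F_def ml_survival_def mittag_leffler_def
    using suminf_mult[OF summable_mult, of "\<lambda>r. (- c * s powr \<nu>) ^ r / Gamma (\<nu> * real r + 1)"
        "indicator {0<..<t} s" "(t - s) powr (\<nu> - 1)"]
      suminf_mult[of "\<lambda>r. (- c * s powr \<nu>) ^ r / Gamma (\<nu> * real r + 1)" "(t - s) powr (\<nu> - 1)"]
      summable_mittag_leffler[of \<nu> 1 "- c * s powr \<nu>"] assms
    by (simp only: zero_less_one simp_thms)
  ultimately have "(\<lambda>r. G (- c) r) sums (Gamma \<nu> * frac_int \<nu> (ml_survival \<nu> c) t)"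
    using FG gnz by (simp add: has_bochner_integral_iff frac_int_def set_lebesgue_integral_def)
  moreover have G_Suc: "- c / Gamma \<nu> * G (- c) r
      = (- c * t powr \<nu>) ^ Suc r / Gamma (\<nu> * real (Suc r) + 1)" for r
  proof -
    have "\<nu> * real r + (\<nu> + 1) = \<nu> * real (Suc r) + 1"
      by (simp add: algebra_simps)
    then show ?thesis
      using gnz unfolding G_def by (simp only: power_Suc) (simp add: mult_ac)
  qed
  ultimately have "(\<lambda>r. - c / Gamma \<nu> * G (- c) r) sums (- c / Gamma \<nu> * (Gamma \<nu> * frac_int \<nu> (ml_survival \<nu> c) t))"
    by (intro sums_mult)
  then have A: "(\<lambda>r. (- c * t powr \<nu>) ^ Suc r / Gamma (\<nu> * real (Suc r) + 1))
      sums (- c * frac_int \<nu> (ml_survival \<nu> c) t)"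
    unfolding G_Suc using gnz by simp
  have "(\<lambda>r. (- c * t powr \<nu>) ^ Suc r / Gamma (\<nu> * real (Suc r) + 1))
      sums (ml_survival \<nu> c t - 1)"
    using ml_survival_sums[OF assms(1,2), of c t] by (subst sums_Suc_iff) simp
  from sums_unique2[OF A this] show ?thesis by simp
qed

text \<open>
  Inserting the equation into itself \<open>n\<close> times bounds \<open>\<bar>d t\<bar>\<close> by \<open>B\<close> times the \<open>n\<close>-th term of a
  convergent Mittag-Leffler series, and these terms tend to \<open>0\<close>.
\<close>

lemma volterra_unique:
  assumes "0 < \<nu>" "\<nu> \<le> 1" "0 \<le> c"
    and bdd: "\<And>s. 0 < s \<Longrightarrow> s < T \<Longrightarrow> \<bar>d s\<bar> \<le> B"
    and eq: "\<And>t. 0 < t \<Longrightarrow> t < T \<Longrightarrow> d t = - c * frac_int \<nu> d t"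
    and "0 < t" "t < T"
  shows "d t = 0"
proof -
  have bound: "\<bar>d t\<bar> \<le> B * ((c * t powr \<nu>) ^ n / Gamma (\<nu> * real n + 1))"
    if "0 < t" "t < T" for n t
    using that
  proof (induction n arbitrary: t)
    case 0
    then show ?case using bdd by simp
  next
    case (Suc n)
    define F where "F = (\<lambda>s. indicator {0<..<t} s *
      ((t - s) powr (\<nu> - 1) * ((c * s powr \<nu>) ^ n / Gamma (\<nu> * real n + 1))))"
    have F: "has_bochner_integral lborel F
        (Gamma \<nu> * t powr \<nu> * ((c * t powr \<nu>) ^ n / Gamma (\<nu> * real n + (\<nu> + 1))))"
      unfolding F_def using assms Suc.prems by (intro has_bochner_integral_ml_term)
    have le: "norm (indicator {0<..<t} s *\<^sub>R ((t - s) powr (\<nu> - 1) * d s)) \<le> B * F s" for s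
    proof (cases "s \<in> {0<..<t}")
      case True
      then have "\<bar>d s\<bar> \<le> B * ((c * s powr \<nu>) ^ n / Gamma (\<nu> * real n + 1))"
        using Suc.prems by (intro Suc.IH) auto
      from mult_left_mono[OF this, of "(t - s) powr (\<nu> - 1)"] True
      show ?thesis by (simp add: F_def abs_mult mult_ac)
    qed (simp add: F_def)
    have "\<bar>LINT s:{0<..<t}|lborel. (t - s) powr (\<nu> - 1) * d s\<bar>
        \<le> (\<integral>s. norm (indicator {0<..<t} s *\<^sub>R ((t - s) powr (\<nu> - 1) * d s)) \<partial>lborel)"
      unfolding set_lebesgue_integral_def real_norm_def[symmetric] by (rule integral_norm_bound)
    also have "\<dots> \<le> (\<integral>s. B * F s \<partial>lborel)"
      by (rule integral_mono') (use F le order_trans[OF norm_ge_zero le] in \<open>auto simp: has_bochner_integral_iff\<close>)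
    also have "\<dots> = B * (Gamma \<nu> * t powr \<nu> * ((c * t powr \<nu>) ^ n / Gamma (\<nu> * real n + (\<nu> + 1))))"
      using F by (simp add: has_bochner_integral_iff)
    finally have le: "\<bar>LINT s:{0<..<t}|lborel. (t - s) powr (\<nu> - 1) * d s\<bar> \<le> \<dots>" .
    have "\<bar>d t\<bar> = c / Gamma \<nu> * \<bar>LINT s:{0<..<t}|lborel. (t - s) powr (\<nu> - 1) * d s\<bar>"
      using eq[OF Suc.prems] assms Gamma_real_pos[of \<nu>]
      by (simp add: frac_int_def abs_mult)
    also have "\<dots> \<le> c / Gamma \<nu> *
        (B * (Gamma \<nu> * t powr \<nu> * ((c * t powr \<nu>) ^ n / Gamma (\<nu> * real n + (\<nu> + 1)))))"
      using le assms Gamma_real_pos[of \<nu>] by (intro mult_left_mono) auto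
    also have "\<dots> = B * ((c * t powr \<nu>) ^ Suc n / Gamma (\<nu> * real (Suc n) + 1))"
    proof -
      have "Gamma \<nu> \<noteq> 0" using assms(1) by (rule Gamma_nonzero_pos)
      then show ?thesis by (simp add: algebra_simps)
    qed
    finally show ?case .
  qed
  have "(\<lambda>n. B * ((c * t powr \<nu>) ^ n / Gamma (\<nu> * real n + 1))) \<longlonglongrightarrow> B * 0"
    using assms by (intro tendsto_mult_left summable_LIMSEQ_zero summable_mittag_leffler) auto
  then have "\<bar>d t\<bar> \<le> B * 0"
    by (rule LIMSEQ_le_const) (use bound assms in auto)
  then show ?thesis by simp
qed

section \<open>Inverting the Caputo derivative\<close>

text \<open>
  For \<open>\<nu> < 1\<close>, exchanging the order of integration leaves the inner integral of
  \<open>(t - u) powr (\<nu> - 1) * (u - s) powr (- \<nu>)\<close> over \<open>(s, t)\<close>. This is a Beta integral whose value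
  does not depend on \<open>s\<close> and \<open>t\<close> and cancels the normalising constants, so only the ordinary
  integral of \<open>f'\<close> remains. For \<open>\<nu> = 1\<close> both operators are the classical ones.
\<close>

lemma frac_int_caputo_deriv:
  assumes \<nu>: "0 < \<nu>" "\<nu> \<le> 1"
    and cont: "continuous_on {0..} f"
    and diff: "\<And>t. 0 < t \<Longrightarrow> caputo_differentiable \<nu> f t"
    and eq: "\<And>t. 0 < t \<Longrightarrow> caputo_deriv \<nu> f t = g t"
    and g: "continuous_on {0..} g"
    and t: "0 < t"
  shows "frac_int \<nu> g t = f t - f 0"
proof -
  have der: "(f has_vector_derivative deriv f s) (at s)" if "0 < s" for s
  proof -
    have "f field_differentiable (at s)"
      using diff[of s] diff[of "s + 1"] that by (auto simp: caputo_differentiable_def split: if_splits)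
    then show ?thesis
      by (simp add: field_differentiable_derivI has_real_derivative_iff_has_vector_derivative[symmetric])
  qed
  have ftc: "(deriv f has_integral f t - f 0) {0<..<t}"
    unfolding has_integral_Icc_iff_Ioo[symmetric] using t
    by (intro fundamental_theorem_of_calculus_interior der continuous_on_subset[OF cont]) auto
  show ?thesis
  proof (cases "\<nu> = 1")
    case True
    have "(g has_integral f t - f 0) {0<..<t}"
      by (rule has_integral_eq[OF _ ftc]) (use eq True in \<open>auto simp: caputo_deriv_def\<close>)
    moreover have int: "set_integrable lborel {0<..<t} g"
    proof -
      have "set_integrable lborel {0<..<t} (\<lambda>s. (t - s) powr (1 - 1) * g s)"
        by (intro set_integrable_frac loc_bounded_continuous g) auto
      also have "?this \<longleftrightarrow> ?thesis"
        by (rule set_integrable_cong) auto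
      finally show ?thesis .
    qed
    ultimately have "(LINT s:{0<..<t}|lborel. g s) = f t - f 0"
      using set_borel_integral_eq_integral(2)[OF int] by (simp add: integral_unique)
    moreover have "frac_int \<nu> g t = (LINT s:{0<..<t}|lborel. g s)"
    proof -
      have "(LINT s:{0<..<t}|lborel. (t - s) powr (1 - 1) * g s) = (LINT s:{0<..<t}|lborel. g s)"
        by (rule set_lebesgue_integral_cong) auto
      then show ?thesis by (simp add: frac_int_def True)
    qed
    ultimately show ?thesis by simp
  next
    case False
    with \<nu> have \<nu>1: "\<nu> < 1" by simp
    define D where "D = deriv f"
    define K where "K = Gamma (1 - \<nu>) * Gamma \<nu>"
    have K: "K > 0" using \<nu> \<nu>1 by (simp add: K_def Gamma_real_pos)
    have wD: "set_integrable lborel {0<..<t} (\<lambda>s. D s / (t - s) powr \<nu>)"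
      using diff[OF t] False by (simp add: caputo_differentiable_def D_def)
    have meas: "(\<lambda>s. indicator {0<..<t} s * D s) \<in> borel_measurable borel"
    proof -
      have [measurable]: "(\<lambda>s. indicator {0<..<t} s * (D s / (t - s) powr \<nu>)) \<in> borel_measurable borel"
        using wD unfolding set_integrable_def by (auto dest: borel_measurable_integrable)
      have "(\<lambda>s. (indicator {0<..<t} s * (D s / (t - s) powr \<nu>)) * (t - s) powr \<nu>)
          \<in> borel_measurable borel"
        by measurable
      also have "(\<lambda>s. (indicator {0<..<t} s * (D s / (t - s) powr \<nu>)) * (t - s) powr \<nu>)
          = (\<lambda>s. indicator {0<..<t} s * D s)"
        by (auto simp: indicator_def)
      finally show ?thesis .
    qed
    \<comment> \<open>The weight \<open>(t - s) powr \<nu>\<close> is at most \<open>t powr \<nu>\<close>, so the derivative itself is integrable.\<close>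
    have intD: "set_integrable lborel {0<..<t} D"
    proof (rule set_integrable_bound)
      show "set_integrable lborel {0<..<t} (\<lambda>s. t powr \<nu> * (D s / (t - s) powr \<nu>))"
        using wD by (intro set_integrable_mult_right)
      show "set_borel_measurable lborel {0<..<t} D"
        using meas by (simp add: set_borel_measurable_def)
      have "\<bar>D s\<bar> \<le> t powr \<nu> * (\<bar>D s\<bar> / (t - s) powr \<nu>)" if "0 < s" "s < t" for s
      proof -
        have "\<bar>D s\<bar> * (t - s) powr \<nu> \<le> \<bar>D s\<bar> * t powr \<nu>"
          using that \<nu> by (intro mult_left_mono powr_mono2) auto
        with that show ?thesis by (simp add: field_simps)
      qed
      then show "AE s in lborel. s \<in> {0<..<t} \<longrightarrow>
          norm (D s) \<le> norm (t powr \<nu> * (D s / (t - s) powr \<nu>))"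
        by (auto simp: abs_mult)
    qed
    have LD: "(LINT s:{0<..<t}|lborel. D s) = f t - f 0"
      using set_borel_integral_eq_integral(2)[OF intD] ftc by (simp add: integral_unique D_def)
    define k where "k = (\<lambda>s u. if s < u \<and> u < t then (t - u) powr (\<nu> - 1) * (u - s) powr (- \<nu>) else 0)"
    have k: "has_bochner_integral lborel (k s) K" if "s < t" for s
    proof -
      have "has_bochner_integral lborel
          (\<lambda>u. indicator {s<..<t} u * ((t - u) powr (\<nu> - 1) * (u - s) powr ((1 - \<nu>) - 1)))
          (Beta (1 - \<nu>) \<nu> * (t - s) powr (1 - \<nu> + \<nu> - 1))"
        using \<nu> \<nu>1 that by (intro has_bochner_integral_Beta) auto
      also have "(\<lambda>u. indicator {s<..<t} u * ((t - u) powr (\<nu> - 1) * (u - s) powr ((1 - \<nu>) - 1))) = k s"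
        by (auto simp: k_def indicator_def)
      also have "Beta (1 - \<nu>) \<nu> * (t - s) powr (1 - \<nu> + \<nu> - 1) = K"
        using that by (simp add: K_def Beta_def)
      finally show ?thesis .
    qed
    have k_nonneg: "k s u \<ge> 0" for s u by (simp add: k_def)
    define H where "H = (\<lambda>s u. (indicator {0<..<t} s * D s) * k s u)"
    have "integrable (lborel \<Otimes>\<^sub>M lborel) (case_prod H)"
    proof (rule lborel_pair.Fubini_integrable)
      note [measurable] = meas
      show "case_prod H \<in> borel_measurable (lborel \<Otimes>\<^sub>M lborel)"
        unfolding H_def k_def by measurable
      have "(\<integral>u. norm (case_prod H (s, u)) \<partial>lborel) = K * norm (indicator {0<..<t} s *\<^sub>R D s)" for s
        using k[of s] k_nonneg
        by (cases "s \<in> {0<..<t}") (auto simp: H_def abs_mult has_bochner_integral_iff)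
      then show "integrable lborel (\<lambda>s. \<integral>u. norm (case_prod H (s, u)) \<partial>lborel)"
        using intD unfolding set_integrable_def by simp
      have "integrable lborel (H s)" for s
        using k[of s] unfolding H_def
        by (cases "s \<in> {0<..<t}") (auto simp: has_bochner_integral_iff)
      then show "AE s in lborel. integrable lborel (\<lambda>u. case_prod H (s, u))"
        by simp
    qed
    then have "(\<integral>u. (\<integral>s. H s u \<partial>lborel) \<partial>lborel) = (\<integral>s. (\<integral>u. H s u \<partial>lborel) \<partial>lborel)"
      by (rule lborel_pair.Fubini_integral)
    also have "(\<lambda>s. \<integral>u. H s u \<partial>lborel) = (\<lambda>s. K * (indicator {0<..<t} s *\<^sub>R D s))"
    proof
      fix s
      show "(\<integral>u. H s u \<partial>lborel) = K * (indicator {0<..<t} s *\<^sub>R D s)"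
        using k[of s] unfolding H_def
        by (cases "s \<in> {0<..<t}") (auto simp: has_bochner_integral_iff)
    qed
    also have "(\<integral>s. K * (indicator {0<..<t} s *\<^sub>R D s) \<partial>lborel) = K * (f t - f 0)"
      using LD by (simp add: set_lebesgue_integral_def)
    also have "(\<lambda>u. \<integral>s. H s u \<partial>lborel)
        = (\<lambda>u. Gamma (1 - \<nu>) * (indicator {0<..<t} u *\<^sub>R ((t - u) powr (\<nu> - 1) * g u)))"
    proof
      fix u
      show "(\<integral>s. H s u \<partial>lborel) = Gamma (1 - \<nu>) * (indicator {0<..<t} u *\<^sub>R ((t - u) powr (\<nu> - 1) * g u))"
      proof (cases "u \<in> {0<..<t}")
        case True
        then have "(\<lambda>s. H s u)
            = (\<lambda>s. (t - u) powr (\<nu> - 1) * (indicator {0<..<u} s *\<^sub>R (D s / (u - s) powr \<nu>)))"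
          by (auto simp: H_def k_def indicator_def powr_minus_divide)
        then have "(\<integral>s. H s u \<partial>lborel)
            = (t - u) powr (\<nu> - 1) * (LINT s:{0<..<u}|lborel. D s / (u - s) powr \<nu>)"
          by (simp only: set_lebesgue_integral_def integral_mult_right_zero)
        also have "(LINT s:{0<..<u}|lborel. D s / (u - s) powr \<nu>) = Gamma (1 - \<nu>) * g u"
          using eq[of u] True \<open>\<nu> \<noteq> 1\<close> \<nu>1 Gamma_nonzero_pos[of "1 - \<nu>"]
          by (simp add: caputo_deriv_def D_def field_simps)
        finally show ?thesis using True by simp
      next
        case False
        then have "(\<lambda>s. H s u) = (\<lambda>_. 0)"
          by (auto simp: H_def k_def indicator_def)
        with False show ?thesis by simp
      qed
    qed
    finally have "Gamma (1 - \<nu>) * (LINT u:{0<..<t}|lborel. (t - u) powr (\<nu> - 1) * g u) = K * (f t - f 0)"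
      by (simp add: set_lebesgue_integral_def)
    then have "(LINT u:{0<..<t}|lborel. (t - u) powr (\<nu> - 1) * g u) = Gamma \<nu> * (f t - f 0)"
      using Gamma_nonzero_pos[of "1 - \<nu>"] \<nu>1 by (simp add: K_def)
    then show ?thesis
      using Gamma_nonzero_pos[of \<nu>] \<nu> by (simp add: frac_int_def)
  qed
qed

section \<open>The tail cascade\<close>

text \<open>
  In the Yule process \<open>A j t\<close> is the probability of more than \<open>j\<close> individuals at time \<open>t\<close>. The
  population leaves size \<open>j + 1\<close> at rate \<open>lam * (j + 1)\<close>, so this tail probability is the fractional
  integral of that rate times the probability \<open>A j - A (Suc j)\<close> of being at size \<open>j + 1\<close>.
\<close>

definition tail_cascade :: "real \<Rightarrow> real \<Rightarrow> (nat \<Rightarrow> real \<Rightarrow> real) \<Rightarrow> bool" where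
  "tail_cascade lam \<nu> A \<longleftrightarrow>
     (\<forall>j. loc_bounded (A j)) \<and> (\<forall>t>0. A 0 t = 1) \<and>
     (\<forall>j. \<forall>t>0. A (Suc j) t = lam * real (Suc j) * frac_int \<nu> (\<lambda>s. A j s - A (Suc j) s) t)"

text \<open>
  Once the \<open>j\<close>-th functions agree, the difference of the next ones solves a homogeneous Volterra
  equation.
\<close>

lemma tail_cascade_unique:
  assumes "0 < lam" "0 < \<nu>" "\<nu> \<le> 1"
    and A: "tail_cascade lam \<nu> A" and B: "tail_cascade lam \<nu> B" and "0 < t"
  shows "A j t = B j t"
  using \<open>0 < t\<close>
proof (induction j arbitrary: t)
  case 0
  with A B show ?case by (simp add: tail_cascade_def)
next
  case (Suc j)
  have lb: "loc_bounded (A i)" "loc_bounded (B i)" for i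
    using A B by (auto simp: tail_cascade_def)
  let ?c = "lam * real (Suc j)"
  let ?d = "\<lambda>s. A (Suc j) s - B (Suc j) s"
  have "loc_bounded ?d" by (intro loc_bounded_diff lb)
  then obtain C where C: "\<And>s. 0 < s \<Longrightarrow> s < t + 1 \<Longrightarrow> \<bar>?d s\<bar> \<le> C"
    using Suc.prems unfolding loc_bounded_def by (metis add_pos_pos greaterThanLessThan_iff zero_less_one)
  have eq: "?d u = - ?c * frac_int \<nu> ?d u" if u: "0 < u" for u
  proof -
    have "?d u = ?c * (frac_int \<nu> (\<lambda>s. A j s - A (Suc j) s) u - frac_int \<nu> (\<lambda>s. B j s - B (Suc j) s) u)"
      using A B u by (simp add: tail_cascade_def right_diff_distrib)
    also have "frac_int \<nu> (\<lambda>s. B j s - B (Suc j) s) u = frac_int \<nu> (\<lambda>s. A j s - B (Suc j) s) u"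
      by (rule frac_int_cong) (use Suc.IH in auto)
    also have "frac_int \<nu> (\<lambda>s. A j s - A (Suc j) s) u - frac_int \<nu> (\<lambda>s. A j s - B (Suc j) s) u
        = - frac_int \<nu> ?d u"
      using assms by (simp add: frac_int_diff lb)
    finally show ?thesis by simp
  qed
  have "?d t = 0"
    by (rule volterra_unique[where T = "t + 1" and c = ?c and B = C and \<nu> = \<nu>])
       (use assms Suc.prems C eq in auto)
  then show ?case by simp
qed

text \<open>
  The \<open>j\<close>-th finite difference of \<open>l \<mapsto> ml_survival \<nu> (lam * l) t\<close>. The double sum of the
  theorem collapses to it by Pascal's rule, and in this form the cascade needs only absorption.
\<close>

definition ml_tail :: "real \<Rightarrow> real \<Rightarrow> nat \<Rightarrow> real \<Rightarrow> real" where
  "ml_tail lam \<nu> j t = (\<Sum>l\<le>j. real (j choose l) * (-1) ^ l * ml_survival \<nu> (lam * real l) t)"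

lemma ml_tail_conv_double_sum:
  "ml_tail lam \<nu> j t = 1 - (\<Sum>k=1..j. \<Sum>l=1..k. real ((k - 1) choose (l - 1)) * (-1) ^ (l - 1)
      * ml_survival \<nu> (lam * real l) t)"
proof (induction j)
  case 0
  then show ?case by (simp add: ml_tail_def)
next
  case (Suc j)
  let ?e = "\<lambda>l. ml_survival \<nu> (lam * real l) t"
  have "ml_tail lam \<nu> (Suc j) t = 1 + (\<Sum>l\<le>j. real (Suc j choose Suc l) * (-1) ^ Suc l * ?e (Suc l))"
    unfolding ml_tail_def by (subst sum.atMost_Suc_shift) simp
  moreover have "ml_tail lam \<nu> j t = (\<Sum>l\<le>Suc j. real (j choose l) * (-1) ^ l * ?e l)"
    by (simp add: ml_tail_def)
  then have "ml_tail lam \<nu> j t = 1 + (\<Sum>l\<le>j. real (j choose Suc l) * (-1) ^ Suc l * ?e (Suc l))"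
    by (subst (asm) sum.atMost_Suc_shift) simp
  ultimately have "ml_tail lam \<nu> (Suc j) t - ml_tail lam \<nu> j t
      = - (\<Sum>l\<le>j. real (j choose l) * (-1) ^ l * ?e (Suc l))"
    by (simp add: sum_subtractf[symmetric] sum_negf[symmetric] algebra_simps del: of_nat_Suc)
  also have "(\<Sum>l\<le>j. real (j choose l) * (-1) ^ l * ?e (Suc l))
      = (\<Sum>l=1..Suc j. real ((Suc j - 1) choose (l - 1)) * (-1) ^ (l - 1) * ?e l)"
    unfolding One_nat_def sum.shift_bounds_cl_Suc_ivl by (simp add: atLeast0AtMost)
  finally show ?case using Suc.IH by simp
qed

text \<open>
  The absorption identity turns the factor \<open>lam * (j + 1)\<close> in front of the \<open>l\<close>-th binomial
  coefficient into \<open>lam * l\<close>, the eigenvalue needed to integrate \<open>ml_survival \<nu> (lam * l)\<close>.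
  The constants left over form an alternating sum of binomial coefficients and cancel.
\<close>

lemma tail_cascade_ml_tail:
  assumes "0 < \<nu>" "\<nu> \<le> 1"
  shows "tail_cascade lam \<nu> (ml_tail lam \<nu>)"
  unfolding tail_cascade_def
proof (intro conjI allI impI)
  have lb: "loc_bounded (ml_survival \<nu> c)" for c
    by (intro loc_bounded_continuous continuous_on_ml_survival assms)
  show "loc_bounded (ml_tail lam \<nu> j)" for j
    unfolding ml_tail_def[abs_def] by (intro loc_bounded_sum loc_bounded_cmult lb)
  show "ml_tail lam \<nu> 0 t = 1" for t by (simp add: ml_tail_def)
  fix j and t :: real assume t: "0 < t"
  let ?e = "\<lambda>l. ml_survival \<nu> (lam * real l)"
  let ?a = "\<lambda>l. real (Suc j choose l) * (-1) ^ l"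
  have absorb: "real (Suc j) * (real (j choose l) - real (Suc j choose l)) = - real l * real (Suc j choose l)" for l
  proof (cases l)
    case (Suc m)
    have "real (Suc m) * real (Suc j choose Suc m) = real (Suc j) * real (j choose m)"
      using Suc_times_binomial[of m j] by (metis of_nat_mult)
    then show ?thesis by (simp add: Suc algebra_simps del: of_nat_Suc)
  qed simp
  have "lam * real (Suc j) * (ml_tail lam \<nu> j s - ml_tail lam \<nu> (Suc j) s)
      = (\<Sum>l\<le>Suc j. (- ?a l) * (lam * real l * ?e l s))" for s
  proof -
    have "ml_tail lam \<nu> j s = (\<Sum>l\<le>Suc j. real (j choose l) * (-1) ^ l * ?e l s)"
      by (simp add: ml_tail_def)
    then have "real (Suc j) * (ml_tail lam \<nu> j s - ml_tail lam \<nu> (Suc j) s)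
        = (\<Sum>l\<le>Suc j. (real (Suc j) * (real (j choose l) - real (Suc j choose l))) * ((-1) ^ l * ?e l s))"
      unfolding ml_tail_def
      by (simp only: sum_subtractf[symmetric] sum_distrib_left) (simp add: algebra_simps del: of_nat_Suc)
    then show ?thesis
      unfolding absorb by (simp add: sum_distrib_left mult_ac del: of_nat_Suc sum.atMost_Suc)
  qed
  then have "lam * real (Suc j) * frac_int \<nu> (\<lambda>s. ml_tail lam \<nu> j s - ml_tail lam \<nu> (Suc j) s) t
      = frac_int \<nu> (\<lambda>s. \<Sum>l\<le>Suc j. (- ?a l) * (lam * real l * ?e l s)) t"
    by (simp only: frac_int_cmult[symmetric])
  also have "\<dots> = (\<Sum>l\<le>Suc j. (- ?a l) * (lam * real l * frac_int \<nu> (?e l) t))"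
    using assms
    by (subst frac_int_sum) (simp_all only: frac_int_cmult loc_bounded_cmult lb)
  also have "\<dots> = (\<Sum>l\<le>Suc j. (- ?a l) * (1 - ?e l t))"
    using assms t by (simp only: frac_int_ml_survival)
  also have "\<dots> = ml_tail lam \<nu> (Suc j) t - (\<Sum>l\<le>Suc j. (-1) ^ l * real (Suc j choose l))"
    unfolding ml_tail_def by (simp only: sum_subtractf[symmetric]) (simp add: algebra_simps)
  also have "(\<Sum>l\<le>Suc j. (-1) ^ l * real (Suc j choose l)) = 0"
    by (rule choose_alternating_sum) simp
  finally show "ml_tail lam \<nu> (Suc j) t
      = lam * real (Suc j) * frac_int \<nu> (\<lambda>s. ml_tail lam \<nu> j s - ml_tail lam \<nu> (Suc j) s) t"
    by simp
qed

text \<open>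
  The fractional integrals of the equations for \<open>p 1, \<dots>, p (Suc j)\<close> telescope when added: the gain
  of each state is the loss of the preceding one, and only the loss of the last state survives.
\<close>

lemma tail_cascade_yule:
  assumes "0 < \<nu>" "\<nu> \<le> 1" and p: "fractional_yule_system lam \<nu> p"
  shows "tail_cascade lam \<nu> (\<lambda>j t. 1 - (\<Sum>k=1..j. p k t))"
  unfolding tail_cascade_def
proof (intro conjI allI impI)
  have cont: "continuous_on {0..} (p k)" if "k \<ge> 1" for k
    using p that by (simp add: fractional_yule_system_def)
  then show "loc_bounded (\<lambda>t. 1 - (\<Sum>k=1..j. p k t))" for j
    by (intro loc_bounded_continuous continuous_intros) auto
  show "1 - (\<Sum>k=1..0. p k t) = 1" for t by simp
  define q where "q = (\<lambda>k t. lam * real k * p k t)"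
  have q0: "q 0 = (\<lambda>_. 0)" by (simp add: q_def)
  have contq: "continuous_on {0..} (q k)" for k
  proof (cases "k = 0")
    case False
    then show ?thesis unfolding q_def by (intro continuous_intros cont) auto
  qed (simp add: q0)
  have step: "p (Suc k) t = (if k = 0 then 1 else 0) + frac_int \<nu> (q k) t - frac_int \<nu> (q (Suc k)) t"
    if t: "0 < t" for k t
  proof -
    have "frac_int \<nu> (\<lambda>t. q k t - q (Suc k) t) t = p (Suc k) t - p (Suc k) 0"
    proof (rule frac_int_caputo_deriv)
      show "continuous_on {0..} (\<lambda>t. q k t - q (Suc k) t)"
        by (intro continuous_intros contq)
      show "caputo_differentiable \<nu> (p (Suc k)) t" if "0 < t" for t
        using p that by (simp add: fractional_yule_system_def)
      show "caputo_deriv \<nu> (p (Suc k)) t = q k t - q (Suc k) t" if "0 < t" for t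
      proof -
        have "caputo_deriv \<nu> (p (Suc k)) t
            = - lam * real (Suc k) * p (Suc k) t + lam * (real (Suc k) - 1) * p (Suc k - 1) t"
          using p that unfolding fractional_yule_system_def by (metis One_nat_def Suc_le_mono le0)
        then show ?thesis by (simp add: q_def)
      qed
    qed (use assms cont t in auto)
    moreover have "p (Suc k) 0 = (if k = 0 then 1 else 0)"
      using p by (auto simp: fractional_yule_system_def)
    ultimately show ?thesis
      using assms(1) by (simp add: frac_int_diff loc_bounded_continuous contq)
  qed
  have tail: "1 - (\<Sum>k=1..Suc j. p k t) = frac_int \<nu> (q (Suc j)) t" if t: "0 < t" for j t
  proof (induction j)
    case 0
    show ?case using step[OF t, of 0] by (simp add: q0 frac_int_def)
  next
    case (Suc j)
    then show ?case using step[OF t, of "Suc j"] by simp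
  qed
  fix j and t :: real assume t: "0 < t"
  have "1 - (\<Sum>k=1..Suc j. p k t) = lam * real (Suc j) * frac_int \<nu> (p (Suc j)) t"
    unfolding tail[OF t] q_def by (rule frac_int_cmult)
  then show "1 - (\<Sum>k=1..Suc j. p k t)
      = lam * real (Suc j) * frac_int \<nu> (\<lambda>s. 1 - (\<Sum>k=1..j. p k s) - (1 - (\<Sum>k=1..Suc j. p k s))) t"
    by simp
qed

section \<open>Sums of independent waiting times\<close>

lemma nn_integral_frac_int:
  assumes "0 < \<nu>" "loc_bounded f" "\<And>s. 0 \<le> f s" "0 \<le> c"
  shows "(\<integral>\<^sup>+ u. ennreal (indicator {0<..<t} u * (c / Gamma \<nu> * (t - u) powr (\<nu> - 1)) * f u) \<partial>lborel)
    = ennreal (c * frac_int \<nu> f t)"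
proof -
  have "integrable lborel (\<lambda>u. indicator {0<..<t} u *\<^sub>R ((t - u) powr (\<nu> - 1) * f u))"
    using set_integrable_frac[OF assms(1,2)] by (simp add: set_integrable_def)
  then have "integrable lborel (\<lambda>u. c / Gamma \<nu> * (indicator {0<..<t} u *\<^sub>R ((t - u) powr (\<nu> - 1) * f u)))"
    by (rule integrable_mult_right)
  then have "(\<integral>\<^sup>+ u. ennreal (c / Gamma \<nu> * (indicator {0<..<t} u *\<^sub>R ((t - u) powr (\<nu> - 1) * f u))) \<partial>lborel)
      = ennreal (\<integral>u. c / Gamma \<nu> * (indicator {0<..<t} u *\<^sub>R ((t - u) powr (\<nu> - 1) * f u)) \<partial>lborel)"
    by (rule nn_integral_eq_integral) (use assms Gamma_real_pos[OF assms(1)] in auto)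
  also have "(\<integral>u. c / Gamma \<nu> * (indicator {0<..<t} u *\<^sub>R ((t - u) powr (\<nu> - 1) * f u)) \<partial>lborel)
      = c * frac_int \<nu> f t"
    unfolding frac_int_def set_lebesgue_integral_def by (subst integral_mult_right_zero) simp
  finally show ?thesis by (simp add: mult_ac)
qed

lemma (in prob_space) borel_measurable_cdf:
  assumes [measurable]: "random_variable borel X"
  shows "(\<lambda>u::real. \<P>(\<omega> in M. X \<omega> \<le> u)) \<in> borel_measurable borel"
  by (intro borel_measurable_mono monoI finite_measure_mono) auto

lemma (in prob_space) loc_bounded_cdf:
  assumes "random_variable borel X"
  shows "loc_bounded (\<lambda>u::real. \<P>(\<omega> in M. X \<omega> \<le> u))"
proof -
  have "\<exists>B. \<forall>s\<in>{0<..<t}. \<bar>\<P>(\<omega> in M. X \<omega> \<le> s)\<bar> \<le> B" for t :: real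
    by (rule exI[of _ 1]) simp
  with borel_measurable_cdf[OF assms] show ?thesis
    by (simp add: loc_bounded_def set_borel_measurable_def)
qed

text \<open>
  The renewal step. Conditioning on \<open>W\<close>, translating the integration variable by \<open>W\<close> and
  exchanging the integrals replaces the survival function of \<open>X\<close> under the fractional integral by
  the probability of \<open>W \<le> u < X + W\<close>. All integrands are nonnegative, so Tonelli's theorem applies.
\<close>

lemma (in prob_space) cdf_add_frac_int:
  fixes X W :: "'a \<Rightarrow> real"
  assumes indep: "indep_var borel X borel W"
    and X_pos: "AE \<omega> in M. 0 < X \<omega>" and W_nonneg: "AE \<omega> in M. 0 \<le> W \<omega>"
    and \<nu>: "0 < \<nu>" and c: "0 \<le> c"
    and cdf_X: "\<And>u. 0 < u \<Longrightarrow>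
      \<P>(\<omega> in M. X \<omega> \<le> u) = c * frac_int \<nu> (\<lambda>s. 1 - \<P>(\<omega> in M. X \<omega> \<le> s)) u"
  shows "\<P>(\<omega> in M. X \<omega> + W \<omega> \<le> t)
    = c * frac_int \<nu> (\<lambda>u. \<P>(\<omega> in M. W \<omega> \<le> u) - \<P>(\<omega> in M. X \<omega> + W \<omega> \<le> u)) t"
proof -
  have X[measurable]: "random_variable borel X" and W[measurable]: "random_variable borel W"
    and joint: "distr M borel X \<Otimes>\<^sub>M distr M borel W = distr M (borel \<Otimes>\<^sub>M borel) (\<lambda>\<omega>. (X \<omega>, W \<omega>))"
    using indep unfolding indep_var_distribution_eq by auto
  define \<tau> where "\<tau> = distr M borel X"
  define \<mu> where "\<mu> = distr M borel W"
  interpret \<tau>: prob_space \<tau> unfolding \<tau>_def by (rule prob_space_distr) simp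
  interpret \<mu>: prob_space \<mu> unfolding \<mu>_def by (rule prob_space_distr) simp
  interpret pair_sigma_finite \<tau> \<mu> ..
  interpret L: pair_sigma_finite \<mu> "lborel :: real measure" ..
  have [measurable_cong]: "sets \<tau> = sets borel" "sets \<mu> = sets borel"
    by (simp_all add: \<tau>_def \<mu>_def)
  define S where "S = (\<lambda>s. 1 - \<P>(\<omega> in M. X \<omega> \<le> s))"
  have S_nonneg: "0 \<le> S s" for s by (simp add: S_def)
  have S_lb: "loc_bounded S"
    unfolding S_def by (intro loc_bounded_diff loc_bounded_const loc_bounded_cdf) simp
  have [measurable]: "S \<in> borel_measurable borel"
    unfolding S_def by (intro borel_measurable_diff borel_measurable_cdf) auto
  have S: "ennreal (S s) = emeasure \<tau> {s<..}" for s
  proof -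
    have "S s = prob (space M - {\<omega>\<in>space M. X \<omega> \<le> s})"
      unfolding S_def by (subst prob_compl) auto
    also have "space M - {\<omega>\<in>space M. X \<omega> \<le> s} = X -` {s<..} \<inter> space M" by auto
    finally show ?thesis by (simp add: \<tau>_def emeasure_distr emeasure_eq_measure)
  qed
  define \<kappa> where "\<kappa> = (\<lambda>v. if 0 < v then c / Gamma \<nu> * v powr (\<nu> - 1) else 0)"
  have [measurable]: "\<kappa> \<in> borel_measurable borel" unfolding \<kappa>_def by measurable
  have \<kappa>_nonneg: "0 \<le> \<kappa> v" for v
    using c Gamma_real_pos[OF \<nu>] by (simp add: \<kappa>_def)
  \<comment> \<open>For \<open>u \<le> 0\<close> both sides vanish, which lets the identity be used at \<open>t - W\<close> whatever its sign.\<close>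
  have F: "emeasure \<tau> {..u} = (\<integral>\<^sup>+ s. ennreal (indicator {0..} s * \<kappa> (u - s) * S s) \<partial>lborel)" for u
  proof (cases "0 < u")
    case True
    have "emeasure \<tau> {..u} = ennreal (\<P>(\<omega> in M. X \<omega> \<le> u))"
      unfolding \<tau>_def by (subst emeasure_distr) (auto simp: emeasure_eq_measure vimage_def Int_def conj_commute)
    also have "\<dots> = ennreal (c * frac_int \<nu> S u)"
      using cdf_X[OF True] by (simp add: S_def)
    also have "\<dots> = (\<integral>\<^sup>+ s. ennreal (indicator {0<..<u} s * (c / Gamma \<nu> * (u - s) powr (\<nu> - 1)) * S s) \<partial>lborel)"
      by (rule nn_integral_frac_int[symmetric]) (use \<nu> c S_lb S_nonneg in auto)
    also have "\<dots> = (\<integral>\<^sup>+ s. ennreal (indicator {0..} s * \<kappa> (u - s) * S s) \<partial>lborel)"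
      by (intro nn_integral_cong_AE eventually_mono[OF AE_lborel_singleton[of 0]])
         (auto simp: \<kappa>_def indicator_def)
    finally show ?thesis .
  next
    case False
    have "emeasure \<tau> {..u} = emeasure M {\<omega>\<in>space M. X \<omega> \<le> u}"
      unfolding \<tau>_def by (subst emeasure_distr) (auto simp: vimage_def Int_def conj_commute)
    also have "\<dots> = 0"
      by (rule emeasure_eq_0_AE) (use X_pos False in \<open>auto elim: eventually_mono\<close>)
    also have "0 = (\<integral>\<^sup>+ s. ennreal (indicator {0..} s * \<kappa> (u - s) * S s) \<partial>lborel)"
    proof -
      have "(\<lambda>s. ennreal (indicator {0..} s * \<kappa> (u - s) * S s)) = (\<lambda>_. 0)"
        using False by (auto simp: \<kappa>_def indicator_def)
      then show ?thesis by simp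
    qed
    finally show ?thesis .
  qed
  have pair: "emeasure M {\<omega>\<in>space M. P (X \<omega>) (W \<omega>)} = (\<integral>\<^sup>+ w. emeasure \<tau> {x. P x w} \<partial>\<mu>)"
    if [measurable]: "Measurable.pred (borel \<Otimes>\<^sub>M borel) (\<lambda>(x, w). P x w)" for P
  proof -
    have A: "{(x, w). P x w} \<in> sets (borel \<Otimes>\<^sub>M borel)"
      using that by (simp add: pred_def space_pair_measure case_prod_unfold)
    have "emeasure M {\<omega>\<in>space M. P (X \<omega>) (W \<omega>)}
        = emeasure (distr M (borel \<Otimes>\<^sub>M borel) (\<lambda>\<omega>. (X \<omega>, W \<omega>))) {(x, w). P x w}"
      using A by (subst emeasure_distr) (auto intro!: arg_cong[where f="emeasure M"])
    also have "\<dots> = emeasure (\<tau> \<Otimes>\<^sub>M \<mu>) {(x, w). P x w}"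
      by (simp add: joint \<tau>_def \<mu>_def)
    also have "\<dots> = (\<integral>\<^sup>+ w. emeasure \<tau> ((\<lambda>x. (x, w)) -` {(x, w). P x w}) \<partial>\<mu>)"
      using A by (intro emeasure_pair_measure_alt2) (simp add: sets_pair_measure_cong[of \<tau> borel \<mu> borel] \<tau>_def \<mu>_def cong: sets_pair_measure_cong)
    finally show ?thesis by simp
  qed
  define R where "R = (\<lambda>u. \<P>(\<omega> in M. W \<omega> \<le> u) - \<P>(\<omega> in M. X \<omega> + W \<omega> \<le> u))"
  have R: "emeasure M {\<omega>\<in>space M. W \<omega> \<le> u \<and> u < X \<omega> + W \<omega>} = ennreal (R u)" "0 \<le> R u" for u
  proof -
    have "\<P>(\<omega> in M. W \<omega> \<le> u)
        = prob ({\<omega>\<in>space M. W \<omega> \<le> u \<and> u < X \<omega> + W \<omega>} \<union> {\<omega>\<in>space M. X \<omega> + W \<omega> \<le> u})"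
    proof (rule finite_measure_eq_AE)
      show "AE \<omega> in M. \<omega> \<in> {\<omega>\<in>space M. W \<omega> \<le> u} \<longleftrightarrow>
          \<omega> \<in> {\<omega>\<in>space M. W \<omega> \<le> u \<and> u < X \<omega> + W \<omega>} \<union> {\<omega>\<in>space M. X \<omega> + W \<omega> \<le> u}"
        using X_pos by eventually_elim auto
    qed measurable
    also have "\<dots> = \<P>(\<omega> in M. W \<omega> \<le> u \<and> u < X \<omega> + W \<omega>) + \<P>(\<omega> in M. X \<omega> + W \<omega> \<le> u)"
      by (intro finite_measure_Union) auto
    finally have "R u = \<P>(\<omega> in M. W \<omega> \<le> u \<and> u < X \<omega> + W \<omega>)"
      by (simp add: R_def)
    then show "emeasure M {\<omega>\<in>space M. W \<omega> \<le> u \<and> u < X \<omega> + W \<omega>} = ennreal (R u)" "0 \<le> R u"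
      by (simp_all add: emeasure_eq_measure)
  qed
  have "ennreal (\<P>(\<omega> in M. X \<omega> + W \<omega> \<le> t)) = (\<integral>\<^sup>+ w. emeasure \<tau> {x. x + w \<le> t} \<partial>\<mu>)"
    unfolding emeasure_eq_measure[symmetric] by (rule pair) measurable
  also have "\<dots> = (\<integral>\<^sup>+ w. (\<integral>\<^sup>+ s. ennreal (indicator {0..} s * \<kappa> (t - w - s) * S s) \<partial>lborel) \<partial>\<mu>)"
  proof (rule nn_integral_cong)
    fix w
    have "{x. x + w \<le> t} = {..t - w}" by auto
    then show "emeasure \<tau> {x. x + w \<le> t} = (\<integral>\<^sup>+ s. ennreal (indicator {0..} s * \<kappa> (t - w - s) * S s) \<partial>lborel)"
      by (simp add: F)
  qed
  also have "\<dots> = (\<integral>\<^sup>+ w. (\<integral>\<^sup>+ u. ennreal (indicator {0..} (u - w) * \<kappa> (t - u) * S (u - w)) \<partial>lborel) \<partial>\<mu>)"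
  proof (rule nn_integral_cong)
    fix w
    show "(\<integral>\<^sup>+ s. ennreal (indicator {0..} s * \<kappa> (t - w - s) * S s) \<partial>lborel)
        = (\<integral>\<^sup>+ u. ennreal (indicator {0..} (u - w) * \<kappa> (t - u) * S (u - w)) \<partial>lborel)"
      by (subst nn_integral_real_affine[where c = 1 and t = "- w"]) (simp_all add: algebra_simps)
  qed
  also have "\<dots> = (\<integral>\<^sup>+ u. (\<integral>\<^sup>+ w. ennreal (indicator {0..} (u - w) * \<kappa> (t - u) * S (u - w)) \<partial>\<mu>) \<partial>lborel)"
    by (rule L.Fubini'[symmetric]) measurable
  also have "\<dots> = (\<integral>\<^sup>+ u. ennreal (\<kappa> (t - u)) * ennreal (R u) \<partial>lborel)"
  proof (rule nn_integral_cong)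
    fix u :: real
    have "(\<integral>\<^sup>+ w. ennreal (indicator {0..} (u - w) * \<kappa> (t - u) * S (u - w)) \<partial>\<mu>)
        = (\<integral>\<^sup>+ w. ennreal (\<kappa> (t - u)) * emeasure \<tau> {x. w \<le> u \<and> u < x + w} \<partial>\<mu>)"
    proof (rule nn_integral_cong)
      fix w
      have "{x. w \<le> u \<and> u < x + w} = (if w \<le> u then {u - w<..} else {})" by auto
      then show "ennreal (indicator {0..} (u - w) * \<kappa> (t - u) * S (u - w))
          = ennreal (\<kappa> (t - u)) * emeasure \<tau> {x. w \<le> u \<and> u < x + w}"
        using \<kappa>_nonneg S_nonneg by (simp add: S[symmetric] ennreal_mult)
    qed
    also have "\<dots> = ennreal (\<kappa> (t - u)) * (\<integral>\<^sup>+ w. emeasure \<tau> {x. w \<le> u \<and> u < x + w} \<partial>\<mu>)"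
    proof (rule nn_integral_cmult)
      have "emeasure \<tau> {x. w \<le> u \<and> u < x + w} = ennreal (if w \<le> u then S (u - w) else 0)" for w
      proof -
        have "{x. w \<le> u \<and> u < x + w} = (if w \<le> u then {u - w<..} else {})" by auto
        then show ?thesis by (simp add: S)
      qed
      then show "(\<lambda>w. emeasure \<tau> {x. w \<le> u \<and> u < x + w}) \<in> borel_measurable \<mu>"
        by (simp only:) measurable
    qed
    also have "(\<integral>\<^sup>+ w. emeasure \<tau> {x. w \<le> u \<and> u < x + w} \<partial>\<mu>) = ennreal (R u)"
      unfolding R(1)[symmetric] by (rule pair[symmetric]) measurable
    finally show "(\<integral>\<^sup>+ w. ennreal (indicator {0..} (u - w) * \<kappa> (t - u) * S (u - w)) \<partial>\<mu>)
        = ennreal (\<kappa> (t - u)) * ennreal (R u)" .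
  qed
  also have "\<dots> = (\<integral>\<^sup>+ u. ennreal (indicator {0<..<t} u * (c / Gamma \<nu> * (t - u) powr (\<nu> - 1)) * R u) \<partial>lborel)"
  proof (intro nn_integral_cong_AE eventually_mono[OF AE_lborel_singleton[of 0]])
    fix u :: real assume "u \<noteq> 0"
    have "R u = 0" if "u < 0"
    proof -
      have "ennreal (R u) = 0"
        unfolding R(1)[symmetric]
        by (rule emeasure_eq_0_AE) (use W_nonneg that in \<open>auto elim: eventually_mono\<close>)
      with R(2)[of u] show ?thesis by (simp add: ennreal_eq_0_iff)
    qed
    then have "\<kappa> (t - u) * R u = indicator {0<..<t} u * (c / Gamma \<nu> * (t - u) powr (\<nu> - 1)) * R u"
      using \<open>u \<noteq> 0\<close> by (cases "u < 0") (auto simp: \<kappa>_def indicator_def)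
    then show "ennreal (\<kappa> (t - u)) * ennreal (R u)
        = ennreal (indicator {0<..<t} u * (c / Gamma \<nu> * (t - u) powr (\<nu> - 1)) * R u)"
      using \<kappa>_nonneg[of "t - u"] R(2)[of u] by (simp add: ennreal_mult[symmetric])
  qed
  also have "\<dots> = ennreal (c * frac_int \<nu> R t)"
    by (rule nn_integral_frac_int)
       (use \<nu> c R(2) in \<open>auto simp: R_def intro!: loc_bounded_diff loc_bounded_cdf\<close>)
  finally have "ennreal (\<P>(\<omega> in M. X \<omega> + W \<omega> \<le> t)) = ennreal (c * frac_int \<nu> R t)" .
  moreover have "0 \<le> c * frac_int \<nu> R t"
    using c R(2) Gamma_real_pos[OF \<nu>]
    by (auto simp: frac_int_def set_lebesgue_integral_def intro!: mult_nonneg_nonneg divide_nonneg_nonneg integral_nonneg_AE)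
  ultimately show ?thesis
    by (simp add: R_def)
qed

section \<open>Densities\<close>

text \<open>
  The derivative may be unbounded near \<open>0\<close>, as \<open>t powr (\<nu> - 1)\<close> is, so this rests on the fundamental
  theorem of calculus with differentiability in the open interval only.
\<close>

lemma nn_integral_deriv_half_line:
  assumes cont: "continuous_on {0..} G"
    and der: "\<And>x. 0 < x \<Longrightarrow> (G has_real_derivative f x) (at x)"
    and nonneg: "\<And>x. 0 < x \<Longrightarrow> 0 \<le> f x"
  shows "(\<integral>\<^sup>+ x. ennreal (if 0 < x then f x else 0) * indicator {..a} x \<partial>lborel)
    = ennreal (if a \<le> 0 then 0 else G a - G 0)"
proof (cases "a \<le> 0")
  case True
  then have "(\<lambda>x. ennreal (if 0 < x then f x else 0) * indicator {..a} x) = (\<lambda>_. 0)"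
    by (auto simp: indicator_def)
  with True show ?thesis by simp
next
  case False
  have "(f has_integral G a - G 0) {0<..<a}"
    unfolding has_integral_Icc_iff_Ioo[symmetric] using False der
    by (intro fundamental_theorem_of_calculus_interior continuous_on_subset[OF cont])
       (auto simp: has_real_derivative_iff_has_vector_derivative[symmetric])
  then have "(\<integral>\<^sup>+ x. ennreal (indicator {0<..<a} x * f x) \<partial>lborel) = ennreal (G a - G 0)"
    by (rule nn_integral_has_integral_lebesgue[rotated]) (use nonneg in auto)
  moreover have "(\<integral>\<^sup>+ x. ennreal (if 0 < x then f x else 0) * indicator {..a} x \<partial>lborel)
      = (\<integral>\<^sup>+ x. ennreal (indicator {0<..<a} x * f x) \<partial>lborel)"
    by (intro nn_integral_cong_AE eventually_mono[OF AE_lborel_singleton[of a]])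
       (auto simp: indicator_def)
  ultimately show ?thesis using False by simp
qed

lemma (in prob_space) cdf_ml_density:
  assumes "0 < \<nu>" "\<nu> \<le> 1"
    and pdf: "has_pdf M X (\<lambda>t. if 0 < t then c * t powr (\<nu> - 1) * mittag_leffler \<nu> \<nu> (- c * t powr \<nu>) else 0)"
      (is "has_pdf M X (\<lambda>t. if 0 < t then ?f t else 0)")
    and "0 < t"
  shows "\<P>(\<omega> in M. X \<omega> \<le> t) = 1 - ml_survival \<nu> c t"
proof -
  have X: "distributed M lborel X (\<lambda>x. ennreal (if 0 < x then ?f x else 0))"
    and nonneg: "\<And>x. 0 \<le> (if 0 < x then ?f x else 0)"
    using pdf unfolding has_pdf_def by blast+
  have f_nonneg: "0 \<le> ?f x" if "0 < x" for x
    using nonneg[of x] that by simp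
  have der: "((\<lambda>t. - ml_survival \<nu> c t) has_real_derivative ?f x) (at x)" if "0 < x" for x
    using DERIV_minus[OF DERIV_ml_survival[OF assms(1,2) that, of c]] by simp
  have cont: "continuous_on {0..} (\<lambda>t. - ml_survival \<nu> c t)"
    by (intro continuous_intros continuous_on_ml_survival assms)
  have int: "(\<integral>\<^sup>+ x. ennreal (if 0 < x then ?f x else 0) * indicator {..a} x \<partial>lborel)
      = ennreal (if a \<le> 0 then 0 else - ml_survival \<nu> c a - - ml_survival \<nu> c 0)" for a
    by (rule nn_integral_deriv_half_line[OF cont der f_nonneg])
  have mono: "- ml_survival \<nu> c 0 \<le> - ml_survival \<nu> c t"
    by (rule DERIV_nonneg_imp_increasing_open[of 0 t])
       (use \<open>0 < t\<close> der f_nonneg in \<open>auto intro!: continuous_on_subset[OF cont]\<close>)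
  have "ennreal (\<P>(\<omega> in M. X \<omega> \<le> t)) = emeasure M (X -` {..t} \<inter> space M)"
    by (simp add: emeasure_eq_measure vimage_def Int_def conj_commute)
  also have "\<dots> = (\<integral>\<^sup>+ x. ennreal (if 0 < x then ?f x else 0) * indicator {..t} x \<partial>lborel)"
    by (rule distributed_emeasure[OF X]) simp
  also have "\<dots> = ennreal (1 - ml_survival \<nu> c t)"
    using \<open>0 < t\<close> by (simp add: int)
  finally show ?thesis using mono by simp
qed

section \<open>Waiting times and the Yule process\<close>

text \<open>
  The step from \<open>j\<close> to \<open>Suc j\<close> is the renewal step with \<open>X\<close> the next sojourn time and \<open>W\<close> the
  waiting time so far; its hypothesis is the eigenfunction identity for \<open>ml_survival\<close>.
\<close>

lemma (in prob_space) tail_cascade_waiting_time: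
  assumes "0 < lam" "0 < \<nu>" "\<nu> \<le> 1"
    and indep: "indep_vars (\<lambda>_. borel) T {1..}"
    and rv: "\<And>i. 1 \<le> i \<Longrightarrow> random_variable borel (T i)"
    and pos: "\<And>i. 1 \<le> i \<Longrightarrow> AE \<omega> in M. 0 < T i \<omega>"
    and cdf: "\<And>i t. 1 \<le> i \<Longrightarrow> 0 < t \<Longrightarrow> \<P>(\<omega> in M. T i \<omega> \<le> t) = 1 - ml_survival \<nu> (lam * real i) t"
  shows "tail_cascade lam \<nu> (\<lambda>j t. \<P>(\<omega> in M. waiting_time T j \<omega> \<le> t))"
  unfolding tail_cascade_def
proof (intro conjI allI impI)
  have W: "random_variable borel (waiting_time T j)" for j
    unfolding waiting_time_def[abs_def] using rv by (intro borel_measurable_sum) auto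
  then show "loc_bounded (\<lambda>t. \<P>(\<omega> in M. waiting_time T j \<omega> \<le> t))" for j
    by (rule loc_bounded_cdf)
  show "\<P>(\<omega> in M. waiting_time T 0 \<omega> \<le> t) = 1" if "0 < t" for t
    using that by (simp add: waiting_time_def prob_space)
  fix j and t :: real assume "0 < t"
  let ?X = "T (Suc j)" and ?W = "waiting_time T j" and ?c = "lam * real (Suc j)"
  have W_Suc: "waiting_time T (Suc j) \<omega> = ?X \<omega> + ?W \<omega>" for \<omega>
    by (simp add: waiting_time_def)
  have "\<P>(\<omega> in M. ?X \<omega> + ?W \<omega> \<le> t)
      = ?c * frac_int \<nu> (\<lambda>u. \<P>(\<omega> in M. ?W \<omega> \<le> u) - \<P>(\<omega> in M. ?X \<omega> + ?W \<omega> \<le> u)) t"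
  proof (rule cdf_add_frac_int)
    show "indep_var borel ?X borel ?W"
      unfolding waiting_time_def[abs_def]
      by (rule indep_vars_sum) (auto intro!: indep_vars_subset[OF indep])
    show "AE \<omega> in M. 0 < ?X \<omega>" by (rule pos) simp
    have "AE \<omega> in M. \<forall>i\<in>{1..j}. 0 < T i \<omega>"
      by (rule AE_finite_allI) (use pos in auto)
    then show "AE \<omega> in M. 0 \<le> ?W \<omega>"
      unfolding waiting_time_def by eventually_elim (rule sum_nonneg, auto intro: less_imp_le)
    fix u :: real assume u: "0 < u"
    have "\<P>(\<omega> in M. ?X \<omega> \<le> u) = ?c * frac_int \<nu> (ml_survival \<nu> ?c) u"
      using cdf[of "Suc j" u] u frac_int_ml_survival[OF assms(2,3) u, of ?c] by simp
    also have "frac_int \<nu> (ml_survival \<nu> ?c) u = frac_int \<nu> (\<lambda>s. 1 - \<P>(\<omega> in M. ?X \<omega> \<le> s)) u"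
      by (rule frac_int_cong) (use cdf[of "Suc j"] in simp)
    finally show "\<P>(\<omega> in M. ?X \<omega> \<le> u) = ?c * frac_int \<nu> (\<lambda>s. 1 - \<P>(\<omega> in M. ?X \<omega> \<le> s)) u" .
  qed (use assms in auto)
  then show "\<P>(\<omega> in M. waiting_time T (Suc j) \<omega> \<le> t)
      = ?c * frac_int \<nu> (\<lambda>u. \<P>(\<omega> in M. ?W \<omega> \<le> u) - \<P>(\<omega> in M. waiting_time T (Suc j) \<omega> \<le> u)) t"
    by (simp only: W_Suc)
qed

lemma yule_tail_prob:
  assumes yule: "fractional_yule_process M N lam \<nu>" and t: "0 \<le> t"
  shows "\<P>(\<omega> in M. N t \<omega> \<ge> j + 1 \<bar> N 0 \<omega> = 1) = 1 - (\<Sum>k=1..j. state_prob M N k t)"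
proof -
  interpret prob_space M using yule by (simp add: fractional_yule_process_def)
  have rv: "N s \<in> M \<rightarrow>\<^sub>M count_space {1..}" if "0 \<le> s" for s
    using yule that by (simp add: fractional_yule_process_def)
  then have rv'[measurable]: "N s \<in> M \<rightarrow>\<^sub>M count_space UNIV" if "0 \<le> s" for s
    by (rule measurable_compose) (use that in simp_all)
  note [measurable] = rv'[OF t] rv'[OF order_refl]
  have Q: "\<P>(\<omega> in M. N 0 \<omega> = 1) > 0"
    using yule by (simp add: fractional_yule_process_def)
  show ?thesis
  proof (induction j)
    case 0
    have "1 \<le> N t \<omega>" if "\<omega> \<in> space M" for \<omega>
      using measurable_space[OF rv[OF t] that] by simp
    then have "{\<omega>\<in>space M. N t \<omega> \<ge> 0 + 1 \<and> N 0 \<omega> = 1} = {\<omega>\<in>space M. N 0 \<omega> = 1}"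
      by auto
    with Q show ?case by (simp add: cond_prob_def)
  next
    case (Suc j)
    have "\<P>(\<omega> in M. N t \<omega> \<ge> j + 1 \<and> N 0 \<omega> = 1)
        = prob ({\<omega>\<in>space M. N t \<omega> \<ge> Suc j + 1 \<and> N 0 \<omega> = 1} \<union> {\<omega>\<in>space M. N t \<omega> = Suc j \<and> N 0 \<omega> = 1})"
      by (rule arg_cong[where f=prob]) auto
    also have "\<dots> = \<P>(\<omega> in M. N t \<omega> \<ge> Suc j + 1 \<and> N 0 \<omega> = 1) + \<P>(\<omega> in M. N t \<omega> = Suc j \<and> N 0 \<omega> = 1)"
      by (rule finite_measure_Union) auto
    finally have "\<P>(\<omega> in M. N t \<omega> \<ge> j + 1 \<bar> N 0 \<omega> = 1)
        = \<P>(\<omega> in M. N t \<omega> \<ge> Suc j + 1 \<bar> N 0 \<omega> = 1) + state_prob M N (Suc j) t"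
      by (simp add: cond_prob_def state_prob_def add_divide_distrib)
    with Suc.IH show ?case by simp
  qed
qed

lemma DERIV_ml_tail:
  assumes "0 < \<nu>" "\<nu> \<le> 1" "0 < t"
  shows "(ml_tail lam \<nu> j has_real_derivative
    (\<Sum>k=1..j. \<Sum>l=1..k. real ((k - 1) choose (l - 1)) * (-1) ^ (l - 1) * (lam * real l)
       * t powr (\<nu> - 1) * mittag_leffler \<nu> \<nu> (- lam * real l * t powr \<nu>))) (at t)"
  unfolding ml_tail_conv_double_sum[abs_def]
  by (rule DERIV_cong[OF DERIV_diff[OF DERIV_const DERIV_sum[OF DERIV_sum[OF
        DERIV_cmult[OF DERIV_ml_survival[OF assms]]]]]])
     (simp add: sum_negf mult_ac)

text \<open>
  Nonnegativity of the density is not visible from its alternating sum; it follows because the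
  density is the derivative of a distribution function.
\<close>

lemma (in prob_space) has_pdf_waiting_time:
  assumes "0 < \<nu>" "\<nu> \<le> 1" and j: "1 \<le> j"
    and rv[measurable]: "random_variable borel W"
    and pos: "AE \<omega> in M. 0 < W \<omega>"
    and cdf: "\<And>t. 0 < t \<Longrightarrow> \<P>(\<omega> in M. W \<omega> \<le> t) = ml_tail lam \<nu> j t"
  shows "has_pdf M W
      (\<lambda>t. if t > 0
           then \<Sum>k=1..j. \<Sum>l=1..k. real ((k - 1) choose (l - 1)) * (-1) ^ (l - 1)
                  * (lam * real l) * t powr (\<nu> - 1)
                  * mittag_leffler \<nu> \<nu> (- lam * real l * t powr \<nu>)
           else 0)"
    (is "has_pdf M W (\<lambda>t. if t > 0 then ?f t else 0)")
proof -
  note der = DERIV_ml_tail[OF assms(1,2), of _ lam j]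
  have "mono_on {0<..} (ml_tail lam \<nu> j)"
  proof (rule mono_onI)
    fix s t :: real assume "s \<in> {0<..}" "t \<in> {0<..}" "s \<le> t"
    then show "ml_tail lam \<nu> j s \<le> ml_tail lam \<nu> j t"
      using cdf[of s, symmetric] cdf[of t, symmetric] by (auto intro!: finite_measure_mono)
  qed
  then have nonneg: "0 \<le> ?f t" if "0 < t" for t
    by (rule mono_on_imp_deriv_nonneg[OF _ der[OF that]]) (use that in \<open>simp add: interior_open\<close>)
  have cont: "continuous_on {0..} (ml_tail lam \<nu> j)"
    unfolding ml_tail_def[abs_def]
    by (intro continuous_intros continuous_on_ml_survival assms)
  have ml0: "ml_tail lam \<nu> j 0 = 0"
    using choose_alternating_sum[of j, where ?'a = real] j by (simp add: ml_tail_def mult.commute)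
  have "mittag_leffler \<nu> \<nu> \<in> borel_measurable borel"
    by (intro borel_measurable_continuous_onI continuous_on_mittag_leffler assms)
  note [measurable] = measurable_compose[OF _ this]
  have "distributed M lborel W (\<lambda>x. ennreal (if x > 0 then ?f x else 0))"
  proof (rule distributedI_borel_atMost)
    show "(\<integral>\<^sup>+ x. ennreal ((if 0 < x then ?f x else 0) * indicator {..a} x) \<partial>lborel)
        = ennreal (if a \<le> 0 then 0 else ml_tail lam \<nu> j a - ml_tail lam \<nu> j 0)" for a
      by (rule trans[OF nn_integral_cong nn_integral_deriv_half_line[OF cont der nonneg]])
         (simp split: split_indicator)
    show "emeasure M {\<omega>\<in>space M. W \<omega> \<le> a}
        = ennreal (if a \<le> 0 then 0 else ml_tail lam \<nu> j a - ml_tail lam \<nu> j 0)" for a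
    proof (cases "a \<le> 0")
      case True
      have "emeasure M {\<omega>\<in>space M. W \<omega> \<le> a} = 0"
        by (rule emeasure_eq_0_AE) (use pos True in \<open>auto elim: eventually_mono\<close>)
      with True show ?thesis by simp
    next
      case False
      then show ?thesis using cdf[of a] by (simp add: emeasure_eq_measure ml0)
    qed
  qed (use nonneg in \<open>auto intro!: AE_I2\<close>)
  with nonneg show ?thesis by (simp add: has_pdf_def)
qed

theorem mainTheorem6:
  fixes M :: "'a measure" and M' :: "'b measure"
    and T :: "nat \<Rightarrow> 'a \<Rightarrow> real" and N :: "real \<Rightarrow> 'b \<Rightarrow> nat"
    and lam \<nu> :: real
  assumes "lam > 0" and "0 < \<nu>" and "\<nu> \<le> 1"
    and "prob_space M"
    and "prob_space.indep_vars M (\<lambda>_. borel) T {1..}"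
    and "\<And>i. i \<ge> 1 \<Longrightarrow> AE \<omega> in M. T i \<omega> > 0"
    and "\<And>i. i \<ge> 1 \<Longrightarrow> has_pdf M (T i)
           (\<lambda>t. if t > 0
                then real i * lam * t powr (\<nu> - 1) * mittag_leffler \<nu> \<nu> (- real i * lam * t powr \<nu>)
                else 0)"
    and "fractional_yule_process M' N lam \<nu>"
  shows "\<forall>j\<ge>1.
    (\<forall>t>0.
       \<P>(\<omega> in M. waiting_time T j \<omega> \<le> t) = \<P>(\<omega> in M'. N t \<omega> \<ge> j + 1 \<bar> N 0 \<omega> = 1) \<and>
       \<P>(\<omega> in M'. N t \<omega> \<ge> j + 1 \<bar> N 0 \<omega> = 1)
         = 1 - (\<Sum>k=1..j. \<Sum>l=1..k. real ((k - 1) choose (l - 1)) * (-1) ^ (l - 1)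
                  * mittag_leffler \<nu> 1 (- lam * real l * t powr \<nu>)) \<and>
       state_prob M' N j t
         = \<P>(\<omega> in M. waiting_time T (j - 1) \<omega> \<le> t) - \<P>(\<omega> in M. waiting_time T j \<omega> \<le> t)) \<and>
    has_pdf M (waiting_time T j)
      (\<lambda>t. if t > 0
           then \<Sum>k=1..j. \<Sum>l=1..k. real ((k - 1) choose (l - 1)) * (-1) ^ (l - 1)
                  * (lam * real l) * t powr (\<nu> - 1)
                  * mittag_leffler \<nu> \<nu> (- lam * real l * t powr \<nu>)
           else 0)"
proof -
  interpret prob_space M by fact
  note \<nu> = \<open>0 < \<nu>\<close> \<open>\<nu> \<le> 1\<close>
  have rv: "random_variable borel (T i)" if "1 \<le> i" for i
    using distributed_measurable[of M lborel "T i"] assms(7)[OF that]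
    unfolding has_pdf_def by auto
  have cdf_T: "\<P>(\<omega> in M. T i \<omega> \<le> t) = 1 - ml_survival \<nu> (lam * real i) t"
    if "1 \<le> i" "0 < t" for i t
  proof (rule cdf_ml_density[OF \<nu> _ that(2)])
    have "real i * lam * s = lam * real i * s" "- real i * lam * s = - (lam * real i) * s" for s
      by simp_all
    then show "has_pdf M (T i) (\<lambda>t. if 0 < t
        then lam * real i * t powr (\<nu> - 1) * mittag_leffler \<nu> \<nu> (- (lam * real i) * t powr \<nu>) else 0)"
      using assms(7)[OF that(1)] by (simp only:)
  qed
  have "tail_cascade lam \<nu> (\<lambda>j t. \<P>(\<omega> in M. waiting_time T j \<omega> \<le> t))"
    using assms rv cdf_T by (intro tail_cascade_waiting_time) auto
  then have waiting: "\<P>(\<omega> in M. waiting_time T j \<omega> \<le> t) = ml_tail lam \<nu> j t" if "0 < t" for j t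
    by (rule tail_cascade_unique[OF assms(1-3) _ tail_cascade_ml_tail[OF \<nu>] that])
  have "tail_cascade lam \<nu> (\<lambda>j t. 1 - (\<Sum>k=1..j. state_prob M' N k t))"
    using assms(8) by (intro tail_cascade_yule \<nu>) (simp add: fractional_yule_process_def)
  then have yule: "1 - (\<Sum>k=1..j. state_prob M' N k t) = ml_tail lam \<nu> j t" if "0 < t" for j t
    by (rule tail_cascade_unique[OF assms(1-3) _ tail_cascade_ml_tail[OF \<nu>] that])
  show ?thesis
  proof (intro allI impI conjI)
    fix j :: nat assume j: "1 \<le> j"
    fix t :: real assume t: "0 < t"
    have tail: "\<P>(\<omega> in M'. N t \<omega> \<ge> j + 1 \<bar> N 0 \<omega> = 1) = ml_tail lam \<nu> j t"
      using yule_tail_prob[OF assms(8), of t j] yule[OF t, of j] t by simp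
    then show "\<P>(\<omega> in M. waiting_time T j \<omega> \<le> t) = \<P>(\<omega> in M'. N t \<omega> \<ge> j + 1 \<bar> N 0 \<omega> = 1)"
      using waiting[OF t] by simp
    show "\<P>(\<omega> in M'. N t \<omega> \<ge> j + 1 \<bar> N 0 \<omega> = 1)
        = 1 - (\<Sum>k=1..j. \<Sum>l=1..k. real ((k - 1) choose (l - 1)) * (-1) ^ (l - 1)
                 * mittag_leffler \<nu> 1 (- lam * real l * t powr \<nu>))"
      unfolding tail ml_tail_conv_double_sum by (simp add: ml_survival_def)
    have "{1..j} = insert j {1..j - 1}" using j by auto
    then have "(\<Sum>k=1..j. state_prob M' N k t) = state_prob M' N j t + (\<Sum>k=1..j - 1. state_prob M' N k t)"
      using j by simp
    then show "state_prob M' N j t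
        = \<P>(\<omega> in M. waiting_time T (j - 1) \<omega> \<le> t) - \<P>(\<omega> in M. waiting_time T j \<omega> \<le> t)"
      using yule[OF t, of j] yule[OF t, of "j - 1"] by (simp add: waiting[OF t])
  next
    fix j :: nat assume j: "1 \<le> j"
    have "AE \<omega> in M. \<forall>i\<in>{1..j}. 0 < T i \<omega>"
      by (rule AE_finite_allI) (use assms(6) in auto)
    then have "AE \<omega> in M. 0 < waiting_time T j \<omega>"
      unfolding waiting_time_def by eventually_elim (rule sum_pos, use j in auto)
    moreover have "random_variable borel (waiting_time T j)"
      unfolding waiting_time_def[abs_def] using rv by (intro borel_measurable_sum) auto
    ultimately show "has_pdf M (waiting_time T j)
      (\<lambda>t. if t > 0
           then \<Sum>k=1..j. \<Sum>l=1..k. real ((k - 1) choose (l - 1)) * (-1) ^ (l - 1)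
                  * (lam * real l) * t powr (\<nu> - 1)
                  * mittag_leffler \<nu> \<nu> (- lam * real l * t powr \<nu>)
           else 0)"
      by (intro has_pdf_waiting_time \<nu> j waiting)
  qed
qed

end
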